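(* Let $X=\overline{\Omega}$, $Y=\overline{U}$ with $\Omega,U\subset\mathbb{R}^d$ open, bounded and convex; let $c(x,y)=\frac12|x-y|^2$; let $\mu\in\mathcal{P}(X)$ be absolutely continuous with respect to the Lebesgue measure with bounded density (also denoted $\mu$); and for each $\nu\in\mathcal{P}(Y)$ let $\mathcal{V}[\nu]$ be a convex function of class $C^2$ on $Y$ such that for every $\nu\in\mathcal{P}(Y)$ and every $x\in X$ the solution of $$\inf_{y\in Y}\Big\{\tfrac12|x-y|^2+\mathcal{V}[\nu](y)\Big\}$$ belongs to $U$. Assume that there exist $\lambda>0$, $C\ge0$ and $M>0$ such that for every $(\nu_1,\nu_2)\in\mathcal{P}(Y)\times\mathcal{P}(Y)$: $$D^2\mathcal{V}[\nu_1]\ge\lambda\,\mathrm{id}\ \text{ on } Y,\qquad \det(\mathrm{id}+D^2\mathcal{V}[\nu_1])\le M\ \text{ on } Y,$$ $$\int_Y|\nabla\mathcal{V}[\nu_1](y)-\nabla\mathcal{V}[\nu_2](y)|\,\mathrm{d}y\le C\,\mathcal{W}_1(\nu_1,\nu_2),$$ and that $$M\,C\,\|\mu\|_{L^\infty}<1+\lambda.$$ Then the map $T:\mathcal{P}(Y)\to\mathcal{P}(Y)$, $T\nu:=\big((\mathrm{id}+\nabla\mathcal{V}[\nu])^{-1}\big)_\#\mu$, is a contraction of $(\mathcal{P}(Y),\mathcal{W}_1)$. Therefore, for every $\nu_0\in\mathcal{P}(Y)$, the sequence $(T^n\nu_0)_n$ converges in the distance $\mathcal{W}_1$ (that is, for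 the weak-$*$ topology) to $\nu$, the unique fixed point of $T$. As a consequence, there exists a unique Cournot-Nash equilibrium.
   Context: $\mathcal{P}(Z)$ is the set of Borel probability measures on $Z$. For $x\in X$, $(\mathrm{id}+\nabla\mathcal{V}[\nu])^{-1}(x)$ denotes the (unique) minimiser $y$ of $\frac12|x-y|^2+\mathcal{V}[\nu](y)$ over $Y$, which, lying in $U$, is characterised by $y+\nabla\mathcal{V}[\nu](y)=x$. $S_\#\mu$ denotes the push-forward of $\mu$ by $S$: $S_\#\mu(B)=\mu(S^{-1}(B))$. The $1$-Wasserstein distance is $\mathcal{W}_1(\nu_1,\nu_2)=\inf_{\eta\in\Pi(\nu_1,\nu_2)}\int_{Y\times Y}|y_1-y_2|\,\mathrm{d}\eta(y_1,y_2)$, where $\Pi(\nu_1,\nu_2)$ is the set of probability measures on $Y\times Y$ with marginals $\nu_1,\nu_2$. Class $C^2$ on $Y$ means up to the boundary (e.g. $C^2$ on a neighbourhood of $Y$), and $A\ge\lambda\,\mathrm{id}$ is meant in the sense of symmetric matrices. A contraction is a map that is Lipschitz with constant strictly less than $1$. A Cournot-Nash equilibrium is a $\gamma\in\mathcal{P}(X\times Y)$ with first marginal $\mu$ such that, denoting by $\nu$ its second marginal, $$\gamma\Big(\Big\{(x,y)\in X\times Y:\ c(x,y)+\mathcal{V}[\nu](y)=\min_{z\in Y}\{c(x,z)+\mathcal{V}[\nu](z)\}\Big\}\Big)=1.$$ *)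

theory Defs
  imports "HOL-Probability.Probability"
begin

definition borel_on :: "'a::topological_space set \<Rightarrow> 'a measure" where
  "borel_on Z = restrict_space borel Z"

text \<open>Lebesgue measure on the Borel subsets of \<open>Z\<close>.\<close>

definition lebesgue_on_borel :: "'a::euclidean_space set \<Rightarrow> 'a measure" where
  "lebesgue_on_borel Z = restrict_space lborel Z"

definition prob_measures :: "'a::topological_space set \<Rightarrow> 'a measure set" where
  "prob_measures Z = {P. prob_space P \<and> sets P = sets (borel_on Z)}"

definition couplings ::
  "'a::topological_space set \<Rightarrow> 'a measure \<Rightarrow> 'a measure \<Rightarrow> ('a \<times> 'a) measure set" where
  "couplings Y \<nu>1 \<nu>2 = {\<eta> \<in> prob_measures (Y \<times> Y).
     distr \<eta> (borel_on Y) fst = \<nu>1 \<and> distr \<eta> (borel_on Y) snd = \<nu>2}"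

text \<open>The real-valued integral and infimum are the intended ones for bounded Borel \<open>Y\<close>:
  the integrand is then bounded and the set of couplings is nonempty.\<close>

definition wasserstein1 ::
  "'a::euclidean_space set \<Rightarrow> 'a measure \<Rightarrow> 'a measure \<Rightarrow> real" where
  "wasserstein1 Y \<nu>1 \<nu>2 =
     (INF \<eta>\<in>couplings Y \<nu>1 \<nu>2. \<integral>p. norm (fst p - snd p) \<partial>\<eta>)"

text \<open>The \<open>L\<^sup>\<infinity>\<close> norm of the density of \<open>\<mu>\<close>; the density is nonnegative, hence no absolute value.
  Meaningful only if \<open>\<mu>\<close> is absolutely continuous.\<close>

definition density_Linf_norm :: "'a::euclidean_space set \<Rightarrow> 'a measure \<Rightarrow> ennreal" where
  "density_Linf_norm X \<mu> =
     esssup (lebesgue_on_borel X) (RN_deriv (lebesgue_on_borel X) \<mu>)"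

definition grad :: "(real^'n \<Rightarrow> real) \<Rightarrow> real^'n \<Rightarrow> real^'n" where
  "grad f y = (THE D. GDERIV f y :> D)"

definition hessian :: "(real^'n \<Rightarrow> real) \<Rightarrow> real^'n \<Rightarrow> real^'n^'n" where
  "hessian f y = jacobian (grad f) (at y)"

text \<open>Class \<open>C\<^sup>2\<close> up to the boundary: \<open>C\<^sup>2\<close> on an open neighbourhood of \<open>Y\<close>.\<close>

definition C2_on :: "(real^'n) set \<Rightarrow> (real^'n \<Rightarrow> real) \<Rightarrow> bool" where
  "C2_on Y f \<longleftrightarrow> (\<exists>W. open W \<and> Y \<subseteq> W \<and>
     f differentiable_on W \<and> grad f differentiable_on W \<and> continuous_on W (hessian f))"

text \<open>The order on symmetric matrices; symmetry itself is not part of the definition.\<close>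

definition loewner_le :: "real^'n^'n \<Rightarrow> real^'n^'n \<Rightarrow> bool" where
  "loewner_le A B \<longleftrightarrow> (\<forall>h. h \<bullet> (A *v h) \<le> h \<bullet> (B *v h))"

definition quad_cost :: "'a::real_normed_vector \<Rightarrow> 'a \<Rightarrow> real" where
  "quad_cost x y = (1/2) * (norm (x - y))\<^sup>2"

text \<open>The map \<open>(id + \<nabla>v)\<inverse>\<close>, defined as the minimiser of
  \<open>y \<mapsto> \<bar>x - y\<bar>\<^sup>2 / 2 + v y\<close> over \<open>Y\<close>.\<close>

definition resolvent ::
  "'a::real_normed_vector set \<Rightarrow> ('a \<Rightarrow> real) \<Rightarrow> 'a \<Rightarrow> 'a" where
  "resolvent Y v x = arg_min_on (\<lambda>y. quad_cost x y + v y) Y"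

definition best_reply_map ::
  "'a::real_normed_vector set \<Rightarrow> ('a measure \<Rightarrow> 'a \<Rightarrow> real) \<Rightarrow> 'a measure
     \<Rightarrow> 'a measure \<Rightarrow> 'a measure" where
  "best_reply_map Y V \<mu> \<nu> = distr \<mu> (borel_on Y) (resolvent Y (V \<nu>))"

definition contraction_on :: "'a set \<Rightarrow> ('a \<Rightarrow> 'a \<Rightarrow> real) \<Rightarrow> ('a \<Rightarrow> 'a) \<Rightarrow> bool" where
  "contraction_on S d f \<longleftrightarrow> f \<in> S \<rightarrow> S \<and>
     (\<exists>k. 0 \<le> k \<and> k < 1 \<and> (\<forall>a\<in>S. \<forall>b\<in>S. d (f a) (f b) \<le> k * d a b))"

text \<open>Convergence against continuous functions on \<open>Y\<close>, i.e. weak-* convergence for compact \<open>Y\<close>.\<close>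

definition weak_star_conv ::
  "'a::topological_space set \<Rightarrow> (nat \<Rightarrow> 'a measure) \<Rightarrow> 'a measure \<Rightarrow> bool" where
  "weak_star_conv Y N \<nu> \<longleftrightarrow> (\<forall>f :: 'a \<Rightarrow> real. continuous_on Y f \<longrightarrow>
     (\<lambda>n. \<integral>y. f y \<partial>N n) \<longlonglongrightarrow> (\<integral>y. f y \<partial>\<nu>))"

text \<open>The minimum over \<open>Y\<close> is written as an infimum; it is attained when \<open>Y\<close> is compact and
  nonempty and the minimised function is continuous.\<close>

definition cournot_nash ::
  "'a::topological_space set \<Rightarrow> 'b::topological_space set \<Rightarrow> ('a \<Rightarrow> 'b \<Rightarrow> real)
     \<Rightarrow> ('b measure \<Rightarrow> 'b \<Rightarrow> real) \<Rightarrow> 'a measure \<Rightarrow> ('a \<times> 'b) measure \<Rightarrow> bool" where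
  "cournot_nash X Y c V \<mu> \<gamma> \<longleftrightarrow>
     \<gamma> \<in> prob_measures (X \<times> Y) \<and> distr \<gamma> (borel_on X) fst = \<mu> \<and>
     (let \<nu> = distr \<gamma> (borel_on Y) snd in
       measure \<gamma> {(x, y). x \<in> X \<and> y \<in> Y \<and> c x y + V \<nu> y = (INF z\<in>Y. c x z + V \<nu> z)} = 1)"

end

theory Submission
  imports Defs
begin

text \<open>Write \<open>R\<^sub>i = (id + \<nabla>V[\<nu>\<^sub>i])\<inverse>\<close>. Since \<open>id + \<nabla>V[\<nu>\<^sub>1]\<close> expands distances by at least \<open>1 + lam\<close> and
  \<open>R\<^sub>1 x\<close>, \<open>R\<^sub>2 x\<close> solve the two critical point equations with the same right-hand side \<open>x\<close>,
  \<open>(1 + lam) \<bar>R\<^sub>1 x - R\<^sub>2 x\<bar> \<le> \<bar>\<nabla>V[\<nu>\<^sub>1] - \<nabla>V[\<nu>\<^sub>2]\<bar>(R\<^sub>2 x)\<close>. Integrating against \<open>\<mu>\<close>, bounding its density and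
  substituting \<open>x = y + \<nabla>V[\<nu>\<^sub>2](y)\<close>, whose Jacobian is at most \<open>M\<close>, gives
  \<open>\<integral>\<bar>R\<^sub>1 - R\<^sub>2\<bar> d\<mu> \<le> k W\<^sub>1(\<nu>\<^sub>1, \<nu>\<^sub>2)\<close> with \<open>k = M C \<parallel>\<mu>\<parallel> / (1 + lam) < 1\<close>, and the left-hand side dominates
  \<open>W\<^sub>1(T \<nu>\<^sub>1, T \<nu>\<^sub>2)\<close>. An equilibrium is concentrated on the graph of the resolvent of its second marginal,
  hence equilibria correspond to fixed points of \<open>T\<close>.\<close>

section \<open>Change of variables over arbitrary finite index types\<close>

text \<open>The change-of-variables theorems of the library require a well-ordered index type; this copy of an
  arbitrary finite type provides one.\<close>

typedef 'a finite_index = "{..<CARD('a::finite)}"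
  by (auto simp: lessThan_def intro!: exI[of _ 0])

setup_lifting type_definition_finite_index

instantiation finite_index :: (finite) "{finite, wellorder}"
begin

lift_definition less_eq_finite_index :: "'a finite_index \<Rightarrow> 'a finite_index \<Rightarrow> bool" is "(\<le>)" .
lift_definition less_finite_index :: "'a finite_index \<Rightarrow> 'a finite_index \<Rightarrow> bool" is "(<)" .

instance
proof
  show "finite (UNIV :: 'a finite_index set)"
    by (simp add: type_definition.univ[OF type_definition_finite_index])
next
  fix P :: "'a finite_index \<Rightarrow> bool" and a :: "'a finite_index"
  assume step: "\<And>x. (\<And>y. y < x \<Longrightarrow> P y) \<Longrightarrow> P x"
  show "P a"
    by (induction a rule: measure_induct_rule[of Rep_finite_index]) (auto intro: step simp: less_finite_index.rep_eq)
qed (transfer; auto)+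

end

lemma card_finite_index: "CARD('a::finite finite_index) = CARD('a)"
  by (simp add: type_definition.card[OF type_definition_finite_index])

text \<open>Conjugation by \<open>b\<close> is a sign-preserving bijection between the permutations
  of the two index types, and it matches the terms of the two Leibniz sums.\<close>

lemma det_reindex:
  fixes A :: "'c::comm_ring_1^'n^'n" and b :: "'m::finite \<Rightarrow> 'n::finite"
  assumes "bij b"
  shows "det (\<chi> i j. A $ b i $ b j) = det A"
proof -
  have *: "map_permutation UNIV b p = b \<circ> p \<circ> inv b" for p
    using assms by (auto simp: map_permutation_def restrict_id_def fun_eq_iff bij_is_surj)
  have ib: "inv b (b i) = i" "b (inv b j) = j" for i j
    using assms by (auto simp: bij_is_inj bij_is_surj surj_f_inv_f)
  show ?thesis
    unfolding det_def
  proof (rule sum.reindex_bij_witness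
      [where i = "\<lambda>q. inv b \<circ> q \<circ> b" and j = "map_permutation UNIV b"])
    fix p assume "p \<in> {p. p permutes (UNIV :: 'm set)}"
    then have p: "p permutes UNIV" by simp
    show "inv b \<circ> map_permutation UNIV b p \<circ> b = p"
      unfolding * by (simp add: fun_eq_iff ib)
    show "map_permutation UNIV b p \<in> {p. p permutes UNIV}"
      using map_permutation_permutes[OF _ p, of b UNIV] assms by simp
    have "sign (map_permutation UNIV b p) = sign p"
      using assms p by (intro sign_map_permutation) (auto simp: bij_is_inj)
    moreover have "(\<Prod>i\<in>UNIV. A $ i $ (b \<circ> p \<circ> inv b) i) = (\<Prod>i\<in>UNIV. (\<chi> i j. A $ b i $ b j) $ i $ p i)"
      by (rule prod.reindex_bij_witness[where i = b and j = "inv b"]) (auto simp: ib)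
    ultimately show "of_int (sign (map_permutation UNIV b p)) * (\<Prod>i\<in>UNIV. A $ i $ map_permutation UNIV b p i) =
        of_int (sign p) * (\<Prod>i\<in>UNIV. (\<chi> i j. A $ b i $ b j) $ i $ p i)"
      by (simp add: *)
  next
    fix q assume "q \<in> {p. p permutes (UNIV :: 'n set)}"
    then have q: "q permutes UNIV" by simp
    show "map_permutation UNIV b (inv b \<circ> q \<circ> b) = q"
      unfolding * by (simp add: fun_eq_iff ib)
    have "bij (inv b \<circ> q \<circ> b)"
      using assms q by (auto intro!: bij_comp bij_imp_bij_inv simp: permutes_bij)
    then show "inv b \<circ> q \<circ> b \<in> {p. p permutes UNIV}"
      by (auto intro: bij_imp_permutes)
  qed
qed

section \<open>Lebesgue measure under a relabelling of coordinates\<close>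

definition reindex :: "('m \<Rightarrow> 'n) \<Rightarrow> 'c^'n \<Rightarrow> 'c^'m" where
  "reindex b x = (\<chi> i. x $ b i)"

lemma reindex_nth [simp]: "reindex b x $ i = x $ b i"
  by (simp add: reindex_def)

lemma bounded_linear_reindex: "bounded_linear (reindex b :: real^'n::finite \<Rightarrow> real^'m::finite)"
  unfolding linear_conv_bounded_linear[symmetric] by (auto intro!: linearI simp: vec_eq_iff)

lemma reindex_reindex_inv:
  assumes "bij b"
  shows "reindex b (reindex (inv b) x) = x" "reindex (inv b) (reindex b y) = y"
  using assms by (auto simp: vec_eq_iff bij_is_inj bij_is_surj surj_f_inv_f)

text \<open>Lebesgue measure is determined by the volumes of boxes, and the preimage of a box is a
  box with the same side lengths in another order.\<close>

lemma distr_lborel_reindex: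
  fixes b :: "'m::finite \<Rightarrow> 'n::finite"
  assumes "bij b"
  shows "distr lborel lborel (reindex b) = (lborel :: (real^'m) measure)"
proof (rule lborel_eqI[symmetric])
  have [measurable]: "reindex b \<in> borel_measurable (borel :: (real^'n) measure)"
    by (intro borel_measurable_continuous_onI linear_continuous_on bounded_linear_reindex)
  fix l u :: "real^'m"
  assume "\<And>a. a \<in> Basis \<Longrightarrow> l \<bullet> a \<le> u \<bullet> a"
  then have le: "l $ i \<le> u $ i" for i
    by (metis axis_in_Basis_iff cart_eq_inner_axis Basis_real_def insertI1)
  have ib: "inv b (b i) = i" "b (inv b j) = j" for i j
    using assms by (auto simp: bij_is_inj bij_is_surj surj_f_inv_f)
  have P: "(\<Prod>a\<in>Basis. w \<bullet> a) = (\<Prod>i\<in>UNIV. w $ i)" for w :: "real^'k::finite"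
  proof -
    have "(Basis :: (real^'k) set) = range (\<lambda>i. axis i 1)"
      by (auto simp: Basis_vec_def)
    moreover have "inj (\<lambda>i. axis i (1::real) :: real^'k)"
      by (auto simp: inj_def axis_eq_axis)
    ultimately show ?thesis
      by (subst \<open>Basis = _\<close>, subst prod.reindex) (auto simp: inner_axis)
  qed
  have "reindex b -` box l u = box (reindex (inv b) l) (reindex (inv b) u)"
    unfolding set_eq_iff vimage_eq mem_box_cart reindex_nth
    by (metis ib)
  then have "emeasure (distr lborel lborel (reindex b)) (box l u)
      = emeasure lborel (box (reindex (inv b) l) (reindex (inv b) u))"
    by (simp add: emeasure_distr)
  also have "\<dots> = (\<Prod>a\<in>Basis. (reindex (inv b) u - reindex (inv b) l) \<bullet> a)"
    by (rule emeasure_lborel_box) (auto simp: Basis_vec_def inner_axis le)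
  also have "\<dots> = (\<Prod>a\<in>Basis. (u - l) \<bullet> a)"
    unfolding P
    by (intro arg_cong[where f=ennreal] prod.reindex_bij_witness[where i = b and j = "inv b"]) (auto simp: ib)
  finally show "emeasure (distr lborel lborel (reindex b)) (box l u) = (\<Prod>a\<in>Basis. (u - l) \<bullet> a)" .
qed simp

section \<open>Integrals over images of compact sets\<close>

lemma nn_integral_continuous_on_compact:
  fixes f :: "'a::euclidean_space \<Rightarrow> real"
  assumes "compact S" "continuous_on S f" "\<And>x. x \<in> S \<Longrightarrow> 0 \<le> f x"
  shows "(\<integral>\<^sup>+x\<in>S. f x \<partial>lborel) = ennreal (LINT x:S|lborel. f x)"
proof -
  have "(\<integral>\<^sup>+x\<in>S. f x \<partial>lborel) = (\<integral>\<^sup>+x. ennreal (indicator S x *\<^sub>R f x) \<partial>lborel)"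
    by (intro nn_integral_cong) (auto split: split_indicator)
  also have "\<dots> = ennreal (LINT x:S|lborel. f x)"
    unfolding set_lebesgue_integral_def
    using assms by (intro nn_integral_eq_integral borel_integrable_compact) (auto split: split_indicator)
  finally show ?thesis .
qed

text \<open>Change of variables as an inequality, because \<open>g\<close> may cover points of the
  image several times. Compactness and continuity make the integrands integrable, so that the
  Henstock-Kurzweil, Lebesgue and nonnegative integrals agree.\<close>

lemma nn_integral_image_le_wellorder:
  fixes g :: "real^'m::{finite,wellorder} \<Rightarrow> real^'m::_"
  assumes S: "compact S"
    and der: "\<And>x. x \<in> S \<Longrightarrow> (g has_derivative g' x) (at x within S)"
    and cont_det: "continuous_on S (\<lambda>x. det (matrix (g' x)))"
    and bound: "\<And>x. x \<in> S \<Longrightarrow> \<bar>det (matrix (g' x))\<bar> \<le> M"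
    and M: "0 \<le> M"
    and f: "continuous_on (g ` S) f" "\<And>y. y \<in> g ` S \<Longrightarrow> 0 \<le> f y"
  shows "(\<integral>\<^sup>+y\<in>g ` S. ennreal (f y) \<partial>lborel) \<le> ennreal M * (\<integral>\<^sup>+x\<in>S. ennreal (f (g x)) \<partial>lborel)"
proof -
  have g: "continuous_on S g"
    using der by (rule has_derivative_continuous_on)
  have fg: "continuous_on S (\<lambda>x. f (g x))"
    using continuous_on_compose2[OF f(1) g] by auto
  have int: "set_integrable lborel K h" if "compact K" "continuous_on K h" for h :: "_ \<Rightarrow> real" and K :: "(real^'m::{finite,wellorder}) set"
    using borel_integrable_compact[OF that] by (simp add: set_integrable_def)
  have eq: "(LINT x:K|lborel. h x) = integral K h" if "compact K" "continuous_on K h"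
    for h :: "_ \<Rightarrow> real" and K :: "(real^'m::{finite,wellorder}) set"
    using int[OF that] by (rule set_borel_integral_eq_integral)
  note cont = continuous_on_mult[OF continuous_on_rabs[OF cont_det] fg]
  have "integral (g ` S) f \<le> integral S (\<lambda>x. \<bar>det (matrix (g' x))\<bar> * f (g x))"
    using der f int[OF S cont]
    by (intro integral_on_image_ubound) (auto intro: set_borel_integral_eq_integral)
  also have "\<dots> \<le> integral S (\<lambda>x. M * f (g x))"
    using bound f(2) int[OF S cont] int[OF S continuous_on_mult[OF continuous_on_const fg]]
    by (intro integral_le mult_right_mono set_borel_integral_eq_integral) auto
  also have "\<dots> = M * integral S (\<lambda>x. f (g x))"
    by simp
  finally have "(LINT y:g ` S|lborel. f y) \<le> M * (LINT x:S|lborel. f (g x))"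
    using S f fg g by (simp add: eq compact_continuous_image)
  then show ?thesis
    using S f fg g M
    by (simp add: nn_integral_continuous_on_compact compact_continuous_image ennreal_mult'[symmetric] ennreal_leI)
qed

text \<open>Conjugation by the relabelling \<open>\<phi>\<close> carries the claim to the
  well-ordered copy of the index type: \<open>\<phi>\<close> preserves Lebesgue measure, and the
  Jacobian matrix only has its rows and columns relabelled simultaneously, which leaves its
  determinant unchanged.\<close>

lemma nn_integral_image_le:
  fixes g :: "real^'n \<Rightarrow> real^'n"
  assumes S: "compact S"
    and der: "\<And>x. x \<in> S \<Longrightarrow> (g has_derivative g' x) (at x within S)"
    and cont_det: "continuous_on S (\<lambda>x. det (matrix (g' x)))"
    and bound: "\<And>x. x \<in> S \<Longrightarrow> \<bar>det (matrix (g' x))\<bar> \<le> M"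
    and M: "0 \<le> M"
    and f: "continuous_on (g ` S) f" "\<And>y. y \<in> g ` S \<Longrightarrow> 0 \<le> f y"
  shows "(\<integral>\<^sup>+y\<in>g ` S. ennreal (f y) \<partial>lborel) \<le> ennreal M * (\<integral>\<^sup>+x\<in>S. ennreal (f (g x)) \<partial>lborel)"
proof -
  obtain b :: "'n finite_index \<Rightarrow> 'n" where b: "bij b"
    using card_finite_index[where 'a='n] by (metis finite_same_card_bij finite)
  define \<phi> :: "real^'n \<Rightarrow> real^'n finite_index" where "\<phi> = reindex b"
  define \<psi> :: "real^'n finite_index \<Rightarrow> real^'n" where "\<psi> = reindex (inv b)"
  have inv [simp]: "\<phi> (\<psi> x) = x" "\<psi> (\<phi> y) = y" for x y
    by (simp_all add: \<phi>_def \<psi>_def reindex_reindex_inv[OF b])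
  have lin: "bounded_linear \<phi>" "bounded_linear \<psi>"
    unfolding \<phi>_def \<psi>_def by (rule bounded_linear_reindex)+
  note cont_lin = linear_continuous_on[OF lin(1)] linear_continuous_on[OF lin(2)]
  have transfer: "(\<integral>\<^sup>+x\<in>K. h x \<partial>lborel) = (\<integral>\<^sup>+y\<in>\<phi> ` K. h (\<psi> y) \<partial>lborel)"
    if "compact K" "continuous_on K h" for h :: "real^'n \<Rightarrow> real" and K
  proof -
    have K: "compact (\<phi> ` K)"
      using that cont_lin by (intro compact_continuous_image) auto
    have h: "continuous_on (\<phi> ` K) (\<lambda>y. h (\<psi> y))"
      by (rule continuous_on_compose2[OF that(2) cont_lin(2)]) auto
    have m1: "\<phi> \<in> borel_measurable borel"
      by (intro borel_measurable_continuous_onI cont_lin)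
    \<comment> \<open>Continuity of \<open>h\<close> is known on \<open>K\<close> only, so
      measurability is available for the extension by zero.\<close>
    have "(\<lambda>y. indicator (\<phi> ` K) y *\<^sub>R h (\<psi> y)) \<in> borel_measurable borel"
      using borel_integrable_compact[OF K h] by simp
    then have m2: "(\<lambda>y. ennreal (indicator (\<phi> ` K) y *\<^sub>R h (\<psi> y))) \<in> borel_measurable borel"
      by measurable
    have e: "ennreal (h (\<psi> y)) * indicator (\<phi> ` K) y = ennreal (indicator (\<phi> ` K) y *\<^sub>R h (\<psi> y))" for y
      by (auto split: split_indicator)
    have "(\<integral>\<^sup>+y\<in>\<phi> ` K. h (\<psi> y) \<partial>lborel) = (\<integral>\<^sup>+y. ennreal (indicator (\<phi> ` K) y *\<^sub>R h (\<psi> y)) \<partial>distr lborel lborel \<phi>)"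
      unfolding \<phi>_def distr_lborel_reindex[OF b] by (simp add: e[unfolded \<phi>_def])
    also have "\<dots> = (\<integral>\<^sup>+x. ennreal (indicator (\<phi> ` K) (\<phi> x) *\<^sub>R h x) \<partial>lborel)"
      using m1 m2 by (subst nn_integral_distr) auto
    also have "\<dots> = (\<integral>\<^sup>+x\<in>K. h x \<partial>lborel)"
      by (intro nn_integral_cong) (auto split: split_indicator simp: image_iff dest: arg_cong[where f=\<psi>])
    finally show ?thesis ..
  qed
  have g: "continuous_on S g"
    using der by (rule has_derivative_continuous_on)
  have fg: "continuous_on S (\<lambda>x. f (g x))"
    using continuous_on_compose2[OF f(1) g] by auto
  have comp: "compact (\<phi> ` S)"
    using S cont_lin by (intro compact_continuous_image) auto
  define G where "G = (\<lambda>x. \<phi> (g (\<psi> x)))"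
  define G' where "G' = (\<lambda>x h. \<phi> (g' (\<psi> x) (\<psi> h)))"
  have der': "(G has_derivative G' x) (at x within \<phi> ` S)" if "x \<in> \<phi> ` S" for x
  proof -
    have "(g has_derivative g' (\<psi> x)) (at (\<psi> x) within S)"
      using that der by auto
    then have "(g has_derivative g' (\<psi> x)) (at (\<psi> x) within \<psi> ` \<phi> ` S)"
      by (simp add: image_image)
    from has_derivative_compose[OF diff_chain_within[OF bounded_linear_imp_has_derivative[OF lin(2)] this]
        bounded_linear_imp_has_derivative[OF lin(1)]]
    show ?thesis
      by (simp add: G_def G'_def o_def)
  qed
  have det: "det (matrix (G' x)) = det (matrix (g' (\<psi> x)))" for x
  proof -
    have "matrix (G' x) = (\<chi> i j. matrix (g' (\<psi> x)) $ b i $ b j)"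
    proof -
      have "\<psi> (axis j 1) = axis (b j) 1" for j
        unfolding vec_eq_iff
        using b by (auto simp: \<psi>_def vec_eq_iff axis_def bij_is_inj bij_is_surj surj_f_inv_f)
      then show ?thesis
        by (simp add: matrix_def G'_def) (simp add: \<phi>_def)
    qed
    then show ?thesis
      by (simp add: det_reindex[OF b])
  qed
  have im: "G ` \<phi> ` S = \<phi> ` g ` S"
    by (auto simp: G_def image_image)
  have "(\<integral>\<^sup>+y\<in>g ` S. ennreal (f y) \<partial>lborel) = (\<integral>\<^sup>+y\<in>G ` \<phi> ` S. f (\<psi> y) \<partial>lborel)"
    unfolding im using S g f by (intro transfer compact_continuous_image)
  also have "\<dots> \<le> ennreal M * (\<integral>\<^sup>+x\<in>\<phi> ` S. f (\<psi> (G x)) \<partial>lborel)"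
  proof (rule nn_integral_image_le_wellorder[OF comp der' _ _ M])
    show "continuous_on (\<phi> ` S) (\<lambda>x. det (matrix (G' x)))"
      unfolding det by (rule continuous_on_compose2[OF cont_det cont_lin(2)]) auto
    show "continuous_on (G ` \<phi> ` S) (\<lambda>y. f (\<psi> y))"
      unfolding im by (rule continuous_on_compose2[OF f(1) cont_lin(2)]) auto
  qed (use bound f(2) in \<open>auto simp: det G_def\<close>)
  also have "(\<integral>\<^sup>+x\<in>\<phi> ` S. f (\<psi> (G x)) \<partial>lborel) = (\<integral>\<^sup>+x\<in>S. ennreal (f (g x)) \<partial>lborel)"
    unfolding transfer[OF S fg] by (simp add: G_def)
  finally show ?thesis .
qed

section \<open>Resolvents of uniformly convex potentials\<close>

text \<open>The two derivatives agree in the direction \<open>D - E\<close>, which gives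
  \<open>(D - E) \<bullet> (D - E) = 0\<close>. Uniqueness is what makes the definite description in
  \<open>grad\<close> denote the gradient.\<close>

lemma GDERIV_unique:
  fixes f :: "'a::euclidean_space \<Rightarrow> real"
  assumes "GDERIV f y :> D" "GDERIV f y :> E"
  shows "D = E"
proof -
  have "(\<lambda>h. h \<bullet> D) = (\<lambda>h. h \<bullet> E)"
    using assms unfolding gderiv_def by (rule has_derivative_unique)
  then have "(D - E) \<bullet> D = (D - E) \<bullet> E"
    by (rule fun_cong)
  then have "(D - E) \<bullet> (D - E) = 0"
    by (simp add: inner_diff_right)
  then show ?thesis
    by simp
qed

text \<open>The open neighbourhood in \<open>C2_on\<close> gives full derivatives at the boundary
  points of \<open>Y\<close> too, not only in directions pointing into \<open>Y\<close>.\<close>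

lemma C2_on_has_derivative:
  assumes "C2_on Y f" "y \<in> Y"
  shows "(f has_derivative (\<lambda>h. h \<bullet> grad f y)) (at y)"
    and "(grad f has_derivative (\<lambda>h. hessian f y *v h)) (at y)"
proof -
  obtain W where W: "open W" "y \<in> W" "f differentiable_on W" "grad f differentiable_on W"
    using assms unfolding C2_on_def by blast
  have d: "f differentiable at y" "grad f differentiable at y"
    using W(3,4) unfolding differentiable_on_def by (metis W(1,2) at_within_open)+
  from d(1) obtain f' where f': "(f has_derivative f') (at y)"
    unfolding differentiable_def by blast
  \<comment> \<open>The Riesz representative of the functional \<open>f'\<close> is its adjoint
    applied to \<open>1\<close>.\<close>
  have "f' h = h \<bullet> adjoint f' 1" for h
    using adjoint_works[OF has_derivative_linear[OF f'], of h 1] by simp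
  then have "f' = (\<lambda>h. h \<bullet> adjoint f' 1)"
    by (rule ext)
  then have G: "GDERIV f y :> adjoint f' 1"
    using f' unfolding gderiv_def by simp
  then have "GDERIV f y :> grad f y"
    unfolding grad_def using GDERIV_unique[OF _ G] by (rule theI)
  then show "(f has_derivative (\<lambda>h. h \<bullet> grad f y)) (at y)"
    by (simp add: gderiv_def)
  show "(grad f has_derivative (\<lambda>h. hessian f y *v h)) (at y)"
    using d(2) by (simp only: hessian_def jacobian_works[symmetric])
qed

lemma C2_on_continuous_on:
  assumes "C2_on Y f"
  shows "continuous_on Y f" "continuous_on Y (grad f)" "continuous_on Y (hessian f)"
proof -
  show "continuous_on Y f" "continuous_on Y (grad f)"
    by (rule has_derivative_continuous_on, rule has_derivative_at_withinI,
        erule C2_on_has_derivative[OF assms])+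
  show "continuous_on Y (hessian f)"
    using assms unfolding C2_on_def by (auto intro: continuous_on_subset)
qed

section \<open>Determinants of positive definite matrices\<close>

lemma continuous_on_det:
  fixes A :: "'a::topological_space \<Rightarrow> real^'n^'n"
  assumes "continuous_on S A"
  shows "continuous_on S (\<lambda>x. det (A x))"
  unfolding det_def
  by (intro continuous_on_sum continuous_on_mult continuous_on_const continuous_on_prod
      continuous_on_component assms)

lemma det_pos_of_pos_definite:
  fixes A :: "real^'n^'n"
  assumes "\<And>h. h \<noteq> 0 \<Longrightarrow> 0 < h \<bullet> (A *v h)"
  shows "0 < det A"
proof (rule ccontr)
  \<comment> \<open>A need not be symmetric, so the sign of the determinant is obtained by deforming it to the identity.\<close>
  define B where "B t = (1 - t) *\<^sub>R mat 1 + t *\<^sub>R A" for t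
  assume "\<not> 0 < det A"
  then have "det (B 1) \<le> 0" "0 \<le> det (B 0)"
    by (simp_all add: B_def)
  moreover have "continuous_on {0..1} (\<lambda>t. det (B t))"
    unfolding B_def by (intro continuous_on_det continuous_intros)
  ultimately obtain t where t: "0 \<le> t" "t \<le> 1" "det (B t) = 0"
    using IVT2'[of "\<lambda>t. det (B t)" 1 0 0] by auto
  then obtain h where h: "h \<noteq> 0" "B t *v h = 0"
    using invertible_det_nz[of "B t"] invertible_left_inverse[of "B t"] matrix_left_invertible_ker[of "B t"]
    by metis
  \<comment> \<open>For the kernel vector \<open>h\<close> the left-hand side vanishes, while the
    right-hand side is a convex combination of two positive numbers.\<close>
  have "h \<bullet> (B t *v h) = (1 - t) * (h \<bullet> h) + t * (h \<bullet> (A *v h))"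
    by (simp add: B_def matrix_vector_mult_add_rdistrib scaleR_matrix_vector_assoc[symmetric] inner_add_right)
  moreover have "0 < (1 - t) * (h \<bullet> h) + t * (h \<bullet> (A *v h))"
  proof (cases "t = 0")
    case False
    then show ?thesis
      using t assms[OF h(1)] by (intro add_nonneg_pos mult_nonneg_nonneg mult_pos_pos) auto
  qed (use h in auto)
  ultimately show False
    using h by simp
qed

lemma matrix_vector_mult_mat: "mat c *v h = c *\<^sub>R (h :: real^'n)"
proof -
  have "mat c = c *\<^sub>R (mat 1 :: real^'n^'n)"
    by (simp add: vec_eq_iff mat_def)
  then show ?thesis
    by (simp add: scaleR_matrix_vector_assoc[symmetric])
qed

text \<open>\<open>v\<close> plays the role of \<open>V \<nu>\<close> for one fixed
  \<open>\<nu>\<close>. The results are proved for a single potential and later instantiated with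
  the two potentials that are compared.\<close>

locale admissible_potential =
  fixes X U :: "(real^'n) set" and v :: "real^'n \<Rightarrow> real" and lam :: real
  assumes compact_X: "compact X"
    and open_U: "open U" and bounded_U: "bounded U" and convex_U: "convex U" and U_nonempty: "U \<noteq> {}"
    and lam_pos: "0 < lam"
    and C2: "C2_on (closure U) v"
    and interior_min: "\<And>x y. x \<in> X \<Longrightarrow>
      is_arg_min (\<lambda>y. quad_cost x y + v y) (\<lambda>y. y \<in> closure U) y \<Longrightarrow> y \<in> U"
    and hess_lower: "\<And>y. y \<in> closure U \<Longrightarrow> loewner_le (mat lam) (hessian v y)"
begin

abbreviation "R \<equiv> resolvent (closure U) v"

lemma compact_closure_U: "compact (closure U)"
  using bounded_U by simp

lemmas v_derivative = C2_on_has_derivative(1)[OF C2]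
lemmas grad_derivative = C2_on_has_derivative(2)[OF C2]
lemmas v_continuous = C2_on_continuous_on(1)[OF C2]
lemmas grad_continuous = C2_on_continuous_on(2)[OF C2]
lemmas hessian_continuous = C2_on_continuous_on(3)[OF C2]

text \<open>Along the segment from \<open>z\<close> to \<open>y\<close>, which convexity keeps in
  \<open>closure U\<close>, the derivative of
  \<open>t \<mapsto> grad v (p t) \<bullet> (y - z)\<close> is the Hessian form in the direction
  \<open>y - z\<close>; the mean value theorem turns the lower bound on that form into strong
  monotonicity.\<close>

lemma grad_strongly_monotone:
  assumes y: "y \<in> closure U" and z: "z \<in> closure U"
  shows "lam * (norm (y - z))\<^sup>2 \<le> (grad v y - grad v z) \<bullet> (y - z)"
proof -
  define p where "p t = z + t *\<^sub>R (y - z)" for t :: real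
  have p: "p t \<in> closure U" if "0 \<le> t" "t \<le> 1" for t
  proof -
    have "p t = (1 - t) *\<^sub>R z + t *\<^sub>R y"
      by (simp add: p_def algebra_simps)
    then show ?thesis
      using convexD[OF convex_closure[OF convex_U] z y, of "1 - t" t] that by simp
  qed
  have "((\<lambda>t. grad v (p t) \<bullet> (y - z)) has_derivative
      (\<lambda>s. (hessian v (p t) *v (s *\<^sub>R (y - z))) \<bullet> (y - z))) (at t)" if "0 \<le> t" "t \<le> 1" for t
  proof -
    have "(p has_derivative (\<lambda>s. s *\<^sub>R (y - z))) (at t)"
      unfolding p_def[abs_def] by (auto intro!: derivative_eq_intros)
    then show ?thesis
      using grad_derivative[OF p[OF that]]
      by (intro has_derivative_inner_left) (rule has_derivative_compose[of p])
  qed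
  then have "((\<lambda>t. grad v (p t) \<bullet> (y - z)) has_real_derivative
      (y - z) \<bullet> (hessian v (p t) *v (y - z))) (at t)" if "0 \<le> t" "t \<le> 1" for t
    using that unfolding has_field_derivative_def
    by (simp add: matrix_vector_mult_scaleR inner_commute[of "y - z"] mult_commute_abs)
  then obtain t where t: "0 < t" "t < 1"
    "grad v (p 1) \<bullet> (y - z) - grad v (p 0) \<bullet> (y - z) = (1 - 0) * ((y - z) \<bullet> (hessian v (p t) *v (y - z)))"
    using MVT2[of 0 1 "\<lambda>t. grad v (p t) \<bullet> (y - z)" "\<lambda>t. (y - z) \<bullet> (hessian v (p t) *v (y - z))"] by auto
  have "lam * (norm (y - z))\<^sup>2 \<le> (y - z) \<bullet> (hessian v (p t) *v (y - z))"
    using hess_lower[OF p, of t] t unfolding loewner_le_def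
    by (simp add: matrix_vector_mult_mat power2_norm_eq_inner)
  also have "\<dots> = (grad v y - grad v z) \<bullet> (y - z)"
    using t(3) by (simp add: p_def inner_diff_left)
  finally show ?thesis .
qed

text \<open>The identity adds \<open>1\<close> to the monotonicity constant \<open>lam\<close>, and
  Cauchy-Schwarz followed by division by \<open>norm (y - z)\<close> turns monotonicity into
  expansion.\<close>

lemma id_plus_grad_expansive:
  assumes "y \<in> closure U" "z \<in> closure U"
  shows "(1 + lam) * norm (y - z) \<le> norm ((y + grad v y) - (z + grad v z))"
proof (cases "y = z")
  case False
  have "(1 + lam) * (norm (y - z))\<^sup>2 \<le> ((y + grad v y) - (z + grad v z)) \<bullet> (y - z)"
    using grad_strongly_monotone[OF assms] by (simp add: algebra_simps power2_norm_eq_inner)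
  also have "\<dots> \<le> norm ((y + grad v y) - (z + grad v z)) * norm (y - z)"
    by (rule norm_cauchy_schwarz)
  finally have "((1 + lam) * norm (y - z)) * norm (y - z) \<le> norm ((y + grad v y) - (z + grad v z)) * norm (y - z)"
    by (simp add: power2_eq_square)
  then show ?thesis
    using False by simp
qed simp

text \<open>A minimiser in the open set \<open>U\<close> satisfies the first-order condition as an
  equation rather than a variational inequality. The differential is then tested in the direction of
  the gradient \<open>y + grad v y - x\<close> itself.\<close>

lemma is_arg_min_critical:
  assumes x: "x \<in> X" and y: "is_arg_min (\<lambda>y. quad_cost x y + v y) (\<lambda>y. y \<in> closure U) y"
  shows "y \<in> U" "y + grad v y = x"
proof -
  show yU: "y \<in> U"
    using interior_min[OF x y] .
  then have "(v has_derivative (\<lambda>h. h \<bullet> grad v y)) (at y)"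
    using v_derivative closure_subset by blast
  then have "((\<lambda>y. (1/2) * ((x - y) \<bullet> (x - y)) + v y) has_derivative (\<lambda>h. h \<bullet> (y + grad v y - x))) (at y)"
    by (auto intro!: derivative_eq_intros simp: algebra_simps inner_commute)
  then have "((\<lambda>y. quad_cost x y + v y) has_derivative (\<lambda>h. h \<bullet> (y + grad v y - x))) (at y)"
    by (simp add: quad_cost_def power2_norm_eq_inner)
  then have "(\<lambda>h. h \<bullet> (y + grad v y - x)) = (\<lambda>h. 0)"
    using y closure_subset[of U] unfolding is_arg_min_linorder
    by (intro differential_zero_maxmin[OF yU open_U]) auto
  then have "(y + grad v y - x) \<bullet> (y + grad v y - x) = 0"
    by (rule fun_cong)
  then show "y + grad v y = x"
    by simp
qed

text \<open>All minimisers for the same \<open>x\<close> have the same image \<open>x\<close> under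
  \<open>id + grad v\<close>, and an expansive map is injective.\<close>

lemma is_arg_min_unique:
  assumes "x \<in> X" "is_arg_min (\<lambda>y. quad_cost x y + v y) (\<lambda>y. y \<in> closure U) y"
    "is_arg_min (\<lambda>y. quad_cost x y + v y) (\<lambda>y. y \<in> closure U) z"
  shows "y = z"
proof -
  note y = is_arg_min_critical[OF assms(1,2)] and z = is_arg_min_critical[OF assms(1,3)]
  have "(1 + lam) * norm (y - z) \<le> 0"
    using id_plus_grad_expansive[of y z] y z closure_subset[of U] by auto
  then show ?thesis
    using lam_pos by (simp add: mult_le_0_iff)
qed

text \<open>\<open>resolvent\<close> is a Hilbert choice, which is meaningful once a minimiser
  exists; compactness of \<open>closure U\<close> provides one for every \<open>x\<close>, inside
  \<open>X\<close> or not.\<close>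

lemma resolvent_is_arg_min:
  "is_arg_min (\<lambda>y. quad_cost x y + v y) (\<lambda>y. y \<in> closure U) (R x)"
proof -
  have "continuous_on (closure U) (\<lambda>y. quad_cost x y + v y)"
    unfolding quad_cost_def by (intro continuous_intros v_continuous)
  then have "\<exists>y\<in>closure U. \<forall>z\<in>closure U. quad_cost x y + v y \<le> quad_cost x z + v z"
    using U_nonempty by (intro continuous_attains_inf compact_closure_U) auto
  then obtain y where "y \<in> closure U" "\<And>z. z \<in> closure U \<Longrightarrow> quad_cost x y + v y \<le> quad_cost x z + v z"
    by blast
  then have "is_arg_min (\<lambda>y. quad_cost x y + v y) (\<lambda>y. y \<in> closure U) y"
    by (simp add: is_arg_min_linorder)
  then show ?thesis
    unfolding resolvent_def arg_min_on_def arg_min_def by (rule someI)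
qed

lemma resolvent_in_closure: "R x \<in> closure U"
  using resolvent_is_arg_min by (simp add: is_arg_min_linorder)

lemma resolvent_critical: "x \<in> X \<Longrightarrow> R x + grad v (R x) = x"
  using is_arg_min_critical resolvent_is_arg_min by blast

text \<open>The form in which optimality enters \<open>cournot_nash\<close>. The infimum is attained
  at \<open>R x\<close>, so a point that realises it is itself a minimiser, and minimisers are
  unique.\<close>

lemma resolvent_eq_iff:
  assumes x: "x \<in> X" and y: "y \<in> closure U"
  shows "quad_cost x y + v y = (INF z\<in>closure U. quad_cost x z + v z) \<longleftrightarrow> y = R x"
proof -
  have le: "quad_cost x (R x) + v (R x) \<le> quad_cost x z + v z" if "z \<in> closure U" for z
    using resolvent_is_arg_min[of x] that by (simp add: is_arg_min_linorder)
  then have INF: "(INF z\<in>closure U. quad_cost x z + v z) = quad_cost x (R x) + v (R x)"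
    using resolvent_in_closure[of x] by (intro cInf_eq_minimum) auto
  show ?thesis
  proof
    assume "quad_cost x y + v y = (INF z\<in>closure U. quad_cost x z + v z)"
    then have "is_arg_min (\<lambda>y. quad_cost x y + v y) (\<lambda>y. y \<in> closure U) y"
      using le y by (simp add: INF is_arg_min_linorder)
    then show "y = R x"
      using is_arg_min_unique[OF x _ resolvent_is_arg_min] by blast
  qed (simp add: INF)
qed

text \<open>On \<open>X\<close> the resolvent is a right inverse of a map that expands distances by
  at least \<open>1 + lam\<close>, hence Lipschitz with constant
  \<open>1 / (1 + lam)\<close>.\<close>

lemma resolvent_continuous: "continuous_on X R"
proof (rule lipschitz_on_continuous_on)
  show "(1 / (1 + lam))-lipschitz_on X R"
  proof (rule lipschitz_onI)
    fix x y assume "x \<in> X" "y \<in> X"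
    then show "dist (R x) (R y) \<le> 1 / (1 + lam) * dist x y"
      using id_plus_grad_expansive[of "R x" "R y"] resolvent_in_closure lam_pos
      by (simp add: resolvent_critical dist_norm field_simps)
  qed (use lam_pos in simp)
qed

text \<open>\<open>mat 1 + hessian v y\<close> is positive definite. Positivity turns the upper
  bound on the determinant into a bound on its absolute value, as the change of variables
  requires.\<close>

lemma det_hessian_pos:
  assumes "y \<in> closure U"
  shows "0 < det (mat 1 + hessian v y)"
proof (rule det_pos_of_pos_definite)
  fix h :: "real^'n" assume h: "h \<noteq> 0"
  have "lam * (h \<bullet> h) \<le> h \<bullet> (hessian v y *v h)"
    using hess_lower[OF assms] by (simp add: loewner_le_def matrix_vector_mult_mat)
  moreover have "0 < lam * (h \<bullet> h)"
    using h lam_pos by simp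
  ultimately show "0 < h \<bullet> ((mat 1 + hessian v y) *v h)"
    using h by (simp add: matrix_vector_mult_add_rdistrib inner_add_right add_pos_pos)
qed

text \<open>Substitution \<open>x = g y\<close> with \<open>g = id + grad v\<close> on the compact
  set of all \<open>R x\<close> with \<open>x\<close> in \<open>X\<close>: there \<open>g\<close>
  inverts \<open>R\<close> and maps onto \<open>X\<close>, and its Jacobian is at most
  \<open>M\<close>. Afterwards that set is enlarged to \<open>closure U\<close>.\<close>

lemma nn_integral_resolvent_le:
  assumes det: "\<And>y. y \<in> closure U \<Longrightarrow> det (mat 1 + hessian v y) \<le> M" and M: "0 \<le> M"
    and f: "continuous_on (closure U) f" "\<And>y. y \<in> closure U \<Longrightarrow> 0 \<le> f y"
  shows "(\<integral>\<^sup>+x\<in>X. ennreal (f (R x)) \<partial>lborel) \<le> ennreal M * (\<integral>\<^sup>+y\<in>closure U. ennreal (f y) \<partial>lborel)"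
proof -
  define g where "g y = y + grad v y" for y
  define g' where "g' y h = h + hessian v y *v h" for y h
  have sub: "R ` X \<subseteq> closure U"
    using resolvent_in_closure by auto
  have gR: "g (R x) = x" if "x \<in> X" for x
    using resolvent_critical[OF that] by (simp add: g_def)
  then have im: "g ` R ` X = X"
    by (force simp: image_image)
  have mat: "matrix (g' y) = mat 1 + hessian v y" for y
  proof -
    have "g' y = (\<lambda>h. (mat 1 + hessian v y) *v h)"
      by (simp add: g'_def fun_eq_iff matrix_vector_mult_add_rdistrib)
    then show ?thesis
      by (simp only: matrix_of_matrix_vector_mul)
  qed
  have "(\<integral>\<^sup>+x\<in>g ` R ` X. ennreal (f (R x)) \<partial>lborel)
      \<le> ennreal M * (\<integral>\<^sup>+y\<in>R ` X. ennreal (f (R (g y))) \<partial>lborel)"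
  proof (rule nn_integral_image_le[where g' = g'])
    show "compact (R ` X)"
      by (intro compact_continuous_image resolvent_continuous compact_X)
    show "(g has_derivative g' y) (at y within R ` X)" if "y \<in> R ` X" for y
      unfolding g_def g'_def using that sub
      by (intro has_derivative_add has_derivative_ident has_derivative_at_withinI[OF grad_derivative]) auto
    show "continuous_on (R ` X) (\<lambda>y. det (matrix (g' y)))"
      unfolding mat
      by (intro continuous_on_det continuous_intros continuous_on_subset[OF hessian_continuous sub])
    show "\<bar>det (matrix (g' y))\<bar> \<le> M" if "y \<in> R ` X" for y
      using that sub det det_hessian_pos by (force simp: mat abs_if)
    show "continuous_on (g ` R ` X) (\<lambda>x. f (R x))"
      unfolding im by (rule continuous_on_compose2[OF f(1) resolvent_continuous sub])
  qed (use f M resolvent_in_closure in auto)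
  also have "(\<integral>\<^sup>+y\<in>R ` X. ennreal (f (R (g y))) \<partial>lborel) = (\<integral>\<^sup>+y\<in>R ` X. ennreal (f y) \<partial>lborel)"
    by (intro nn_integral_cong) (auto split: split_indicator simp: gR)
  also have "\<dots> \<le> (\<integral>\<^sup>+y\<in>closure U. ennreal (f y) \<partial>lborel)"
    using sub by (intro nn_integral_mono) (auto split: split_indicator)
  finally show ?thesis
    by (simp add: im mult_left_mono)
qed

end

section \<open>Fixed points and equilibria\<close>

lemma space_borel_on [simp]: "space (borel_on Z) = Z"
  by (simp add: borel_on_def space_restrict_space)

lemma borel_measurable_borel_on:
  fixes f :: "'a::topological_space \<Rightarrow> 'b::topological_space"
  assumes "continuous_on Z f"
  shows "f \<in> borel_measurable (borel_on Z)"
  unfolding borel_on_def using assms by (rule borel_measurable_continuous_on_restrict)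

lemma measurable_borel_on_iff:
  "f \<in> M \<rightarrow>\<^sub>M borel_on Z \<longleftrightarrow> f \<in> borel_measurable M \<and> f ` space M \<subseteq> Z"
  by (auto simp: borel_on_def measurable_restrict_space2_iff)

lemma prob_measures_iff: "P \<in> prob_measures Z \<longleftrightarrow> prob_space P \<and> sets P = sets (borel_on Z)"
  by (simp add: prob_measures_def)

lemma distr_in_prob_measures:
  assumes "prob_space \<mu>" "f \<in> \<mu> \<rightarrow>\<^sub>M borel_on Z"
  shows "distr \<mu> (borel_on Z) f \<in> prob_measures Z"
  using assms by (simp add: prob_measures_def prob_space.prob_space_distr)

lemma distr_Pair_in_couplings:
  assumes "prob_space \<mu>" and \<phi>: "\<phi> \<in> \<mu> \<rightarrow>\<^sub>M borel_on Y" and \<psi>: "\<psi> \<in> \<mu> \<rightarrow>\<^sub>M borel_on Y"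
  shows "distr \<mu> (borel_on (Y \<times> Y)) (\<lambda>x. (\<phi> x, \<psi> x))
    \<in> couplings Y (distr \<mu> (borel_on Y) \<phi>) (distr \<mu> (borel_on Y) (\<psi> :: _ \<Rightarrow> 'a::euclidean_space))"
proof -
  have pair: "(\<lambda>x. (\<phi> x, \<psi> x)) \<in> \<mu> \<rightarrow>\<^sub>M borel_on (Y \<times> Y)"
    using \<phi> \<psi> by (auto simp: measurable_borel_on_iff)
  have proj: "fst \<in> borel_on (Y \<times> Y) \<rightarrow>\<^sub>M borel_on Y" "snd \<in> borel_on (Y \<times> Y) \<rightarrow>\<^sub>M borel_on Y"
    unfolding measurable_borel_on_iff
    by (auto intro!: borel_measurable_borel_on continuous_intros)
  show ?thesis
    using distr_in_prob_measures[OF assms(1) pair]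
    by (simp add: couplings_def distr_distr[OF proj(1) pair] distr_distr[OF proj(2) pair] o_def)
qed

text \<open>The joint law of \<open>\<phi>\<close> and \<open>\<psi>\<close> is a coupling whose
  transport cost is the \<open>L1\<close> distance of the two maps; costs are bounded below by
  \<open>0\<close>, so the infimum lies below this one.\<close>

lemma wasserstein1_distr_le:
  fixes \<phi> \<psi> :: "'b \<Rightarrow> 'a::euclidean_space"
  assumes "prob_space \<mu>" and \<phi>: "\<phi> \<in> \<mu> \<rightarrow>\<^sub>M borel_on Y" and \<psi>: "\<psi> \<in> \<mu> \<rightarrow>\<^sub>M borel_on Y"
  shows "wasserstein1 Y (distr \<mu> (borel_on Y) \<phi>) (distr \<mu> (borel_on Y) \<psi>)
    \<le> (\<integral>x. norm (\<phi> x - \<psi> x) \<partial>\<mu>)"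
proof -
  let ?\<eta> = "distr \<mu> (borel_on (Y \<times> Y)) (\<lambda>x. (\<phi> x, \<psi> x))"
  have pair: "(\<lambda>x. (\<phi> x, \<psi> x)) \<in> \<mu> \<rightarrow>\<^sub>M borel_on (Y \<times> Y)"
    using \<phi> \<psi> by (auto simp: measurable_borel_on_iff)
  have "wasserstein1 Y (distr \<mu> (borel_on Y) \<phi>) (distr \<mu> (borel_on Y) \<psi>)
      \<le> (\<integral>p. norm (fst p - snd p) \<partial>?\<eta>)"
    unfolding wasserstein1_def
    by (intro cINF_lower distr_Pair_in_couplings assms bdd_belowI2[where m = 0]) auto
  also have "\<dots> = (\<integral>x. norm (\<phi> x - \<psi> x) \<partial>\<mu>)"
    by (subst integral_distr[OF pair]) (auto intro!: borel_measurable_borel_on continuous_intros)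
  finally show ?thesis .
qed

text \<open>An infimum over an empty set of reals is unspecified, so a coupling has to be exhibited;
  for two push-forwards of the same \<open>\<mu>\<close> the joint law is one.\<close>

lemma wasserstein1_distr_nonneg:
  fixes \<phi> \<psi> :: "'b \<Rightarrow> 'a::euclidean_space"
  assumes "prob_space \<mu>" "\<phi> \<in> \<mu> \<rightarrow>\<^sub>M borel_on Y" "\<psi> \<in> \<mu> \<rightarrow>\<^sub>M borel_on Y"
  shows "0 \<le> wasserstein1 Y (distr \<mu> (borel_on Y) \<phi>) (distr \<mu> (borel_on Y) \<psi>)"
  unfolding wasserstein1_def using distr_Pair_in_couplings[OF assms] by (intro cINF_greatest) auto

text \<open>An \<open>L\<^sup>1\<close> bound on the distance of the arguments thus controls the difference of integrals of \<open>f\<close>.\<close>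

lemma continuous_on_compact_affine_modulus:
  fixes f :: "'a::metric_space \<Rightarrow> real"
  assumes "compact Y" "continuous_on Y f" "0 < e"
  obtains K where "0 \<le> K" "\<And>a b. a \<in> Y \<Longrightarrow> b \<in> Y \<Longrightarrow> \<bar>f a - f b\<bar> \<le> e + K * dist a b"
proof -
  obtain d where d: "0 < d" "\<And>a b. a \<in> Y \<Longrightarrow> b \<in> Y \<Longrightarrow> dist b a < d \<Longrightarrow> dist (f b) (f a) < e"
    using compact_uniformly_continuous[OF assms(2,1)] assms(3)
    unfolding uniformly_continuous_on_def by metis
  obtain B where B: "0 < B" "\<And>a. a \<in> Y \<Longrightarrow> \<bar>f a\<bar> \<le> B"
    using compact_imp_bounded[OF compact_continuous_image[OF assms(2,1)]]
    unfolding bounded_pos by auto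
  \<comment> \<open>Uniform continuity covers points closer than \<open>d\<close>. For the others
    \<open>dist a b / d\<close> is at least \<open>1\<close>, so the slope \<open>2 * B / d\<close>
    absorbs the largest possible difference \<open>2 * B\<close>.\<close>
  have "\<bar>f a - f b\<bar> \<le> e + 2 * B / d * dist a b" if "a \<in> Y" "b \<in> Y" for a b
  proof (cases "dist a b < d")
    case True
    then have "\<bar>f a - f b\<bar> < e"
      using d(2)[OF that(2,1)] by (simp add: dist_real_def)
    moreover have "0 \<le> 2 * B / d * dist a b"
      using d B by simp
    ultimately show ?thesis by linarith
  next
    case False
    then have "2 * B * d \<le> 2 * B * dist a b"
      using B by simp
    then have "2 * B \<le> 2 * B / d * dist a b"
      using d by (simp add: field_simps)
    moreover have "\<bar>f a - f b\<bar> \<le> 2 * B"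
      using B(2)[OF that(1)] B(2)[OF that(2)] by linarith
    ultimately show ?thesis
      using assms(3) by linarith
  qed
  then show ?thesis
    using that[of "2 * B / d"] B d by simp
qed

text \<open>The estimate \<open>R_lipschitz\<close> on the maps themselves is stronger than
  contraction of \<open>T\<close>: the \<open>L1\<close> distance of the replies dominates the
  Wasserstein distance of their push-forwards. It allows the iteration to take place in a space of
  maps.\<close>

locale contractive_reply =
  fixes X Y :: "'a::euclidean_space set" and \<mu> :: "'a measure"
    and R :: "'a measure \<Rightarrow> 'a \<Rightarrow> 'a" and k :: real
  assumes mu: "\<mu> \<in> prob_measures X"
    and compact_Y: "compact Y" and Y_nonempty: "Y \<noteq> {}"
    and R_measurable: "\<And>\<nu>. \<nu> \<in> prob_measures Y \<Longrightarrow> R \<nu> \<in> borel_on X \<rightarrow>\<^sub>M borel_on Y"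
    and k: "0 \<le> k" "k < 1"
    and R_lipschitz: "\<And>\<nu>1 \<nu>2. \<nu>1 \<in> prob_measures Y \<Longrightarrow> \<nu>2 \<in> prob_measures Y \<Longrightarrow>
      (\<integral>x. norm (R \<nu>1 x - R \<nu>2 x) \<partial>\<mu>) \<le> k * wasserstein1 Y \<nu>1 \<nu>2"
begin

definition T :: "'a measure \<Rightarrow> 'a measure" where
  "T \<nu> = distr \<mu> (borel_on Y) (R \<nu>)"

lemma sets_mu: "sets \<mu> = sets (borel_on X)"
  using mu by (simp add: prob_measures_iff)

lemma space_mu: "space \<mu> = X"
  using sets_eq_imp_space_eq[OF sets_mu] by simp

lemma prob_space_mu: "prob_space \<mu>"
  using mu by (simp add: prob_measures_iff)

sublocale mu: prob_space \<mu>
  by (rule prob_space_mu)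

lemma R_mu: "\<nu> \<in> prob_measures Y \<Longrightarrow> R \<nu> \<in> \<mu> \<rightarrow>\<^sub>M borel_on Y"
  using R_measurable by (simp add: measurable_cong_sets[OF sets_mu refl])

lemma T_in: "\<nu> \<in> prob_measures Y \<Longrightarrow> T \<nu> \<in> prob_measures Y"
  unfolding T_def by (intro distr_in_prob_measures prob_space_mu R_mu)

lemma T_funpow_in: "\<nu> \<in> prob_measures Y \<Longrightarrow> (T ^^ n) \<nu> \<in> prob_measures Y"
  by (induction n) (auto intro: T_in)

lemma measurable_value:
  assumes "\<phi> \<in> \<mu> \<rightarrow>\<^sub>M borel_on Y"
  shows "\<phi> \<in> borel_measurable \<mu>" "x \<in> space \<mu> \<Longrightarrow> \<phi> x \<in> Y"
  using assms by (auto simp: measurable_borel_on_iff)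

lemma norm_diff_le_diameter: "a \<in> Y \<Longrightarrow> b \<in> Y \<Longrightarrow> norm (a - b) \<le> diameter Y"
  using diameter_bounded_bound[OF compact_imp_bounded[OF compact_Y]] by (simp add: dist_norm)

lemma integrable_diff:
  assumes "\<phi> \<in> \<mu> \<rightarrow>\<^sub>M borel_on Y" "\<psi> \<in> \<mu> \<rightarrow>\<^sub>M borel_on Y"
  shows "integrable \<mu> (\<lambda>x. norm (\<phi> x - \<psi> x))"
proof -
  have [measurable]: "\<phi> \<in> borel_measurable \<mu>" "\<psi> \<in> borel_measurable \<mu>"
    using assms measurable_value by auto
  show ?thesis
    by (rule mu.integrable_const_bound[where B = "diameter Y"]) (auto intro!: AE_I2 norm_diff_le_diameter assms[THEN measurable_value(2)])
qed

text \<open>The joint law of the two replies under \<open>\<mu>\<close> couples their push-forwards,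
  so \<open>R_lipschitz\<close> passes to \<open>wasserstein1\<close> with the same
  constant.\<close>

lemma contraction: "contraction_on (prob_measures Y) (wasserstein1 Y) T"
  unfolding contraction_on_def
proof (intro conjI exI[of _ k] ballI)
  fix \<nu>1 \<nu>2 assume \<nu>: "\<nu>1 \<in> prob_measures Y" "\<nu>2 \<in> prob_measures Y"
  have "wasserstein1 Y (T \<nu>1) (T \<nu>2) \<le> (\<integral>x. norm (R \<nu>1 x - R \<nu>2 x) \<partial>\<mu>)"
    unfolding T_def by (intro wasserstein1_distr_le prob_space_mu R_mu \<nu>)
  then show "wasserstein1 Y (T \<nu>1) (T \<nu>2) \<le> k * wasserstein1 Y \<nu>1 \<nu>2"
    using R_lipschitz[OF \<nu>] by simp
qed (use k T_in in auto)

text \<open>Vanishing \<open>L1\<close> distance means equality outside a null set, and a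
  push-forward ignores null sets. This replaces the statement that measures at Wasserstein distance
  \<open>0\<close> are equal.\<close>

lemma distr_eq_of_L1_zero:
  assumes \<phi>: "\<phi> \<in> \<mu> \<rightarrow>\<^sub>M borel_on Y" and \<psi>: "\<psi> \<in> \<mu> \<rightarrow>\<^sub>M borel_on Y"
    and "(\<integral>x. norm (\<phi> x - \<psi> x) \<partial>\<mu>) \<le> 0"
  shows "distr \<mu> (borel_on Y) \<phi> = distr \<mu> (borel_on Y) \<psi>"
proof -
  have "(\<integral>x. norm (\<phi> x - \<psi> x) \<partial>\<mu>) = 0"
    using assms(3) by (intro antisym integral_nonneg) auto
  then have "AE x in \<mu>. norm (\<phi> x - \<psi> x) = 0"
    by (subst (asm) integral_nonneg_eq_0_iff_AE[OF integrable_diff[OF \<phi> \<psi>]]) auto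
  then show ?thesis
    using \<phi> \<psi> by (intro distr_cong_AE) auto
qed

text \<open>For two fixed points the Wasserstein distance is that of their images under
  \<open>T\<close>, hence at most the \<open>L1\<close> distance \<open>?I\<close> of the replies.
  So \<open>?I\<close> is at most \<open>k\<close> times itself and vanishes.\<close>

lemma fixed_point_unique:
  assumes \<nu>: "\<nu> \<in> prob_measures Y" "\<nu>' \<in> prob_measures Y" and fix_eq: "T \<nu> = \<nu>" "T \<nu>' = \<nu>'"
  shows "\<nu> = \<nu>'"
proof -
  let ?I = "\<integral>x. norm (R \<nu> x - R \<nu>' x) \<partial>\<mu>"
  have "?I \<le> k * wasserstein1 Y (T \<nu>) (T \<nu>')"
    using R_lipschitz[OF \<nu>] fix_eq by simp
  also have "\<dots> \<le> k * ?I"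
    unfolding T_def by (intro mult_left_mono wasserstein1_distr_le prob_space_mu R_mu \<nu> k)
  finally have "(1 - k) * ?I \<le> 0"
    by (simp add: algebra_simps)
  then have "?I \<le> 0"
    using k by (simp add: mult_le_0_iff)
  then have "T \<nu> = T \<nu>'"
    unfolding T_def by (intro distr_eq_of_L1_zero R_mu \<nu>)
  then show ?thesis
    using fix_eq by simp
qed

section \<open>Existence of a fixed point by completeness in \<open>L1\<close>\<close>

lemma L1_triangle:
  assumes "\<phi> \<in> \<mu> \<rightarrow>\<^sub>M borel_on Y" "\<psi> \<in> \<mu> \<rightarrow>\<^sub>M borel_on Y" "\<theta> \<in> \<mu> \<rightarrow>\<^sub>M borel_on Y"
  shows "(\<integral>x. norm (\<phi> x - \<theta> x) \<partial>\<mu>) \<le> (\<integral>x. norm (\<phi> x - \<psi> x) \<partial>\<mu>) + (\<integral>x. norm (\<psi> x - \<theta> x) \<partial>\<mu>)"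
proof -
  have "(\<integral>x. norm (\<phi> x - \<theta> x) \<partial>\<mu>) \<le> (\<integral>x. norm (\<phi> x - \<psi> x) + norm (\<psi> x - \<theta> x) \<partial>\<mu>)"
    using assms by (intro integral_mono Bochner_Integration.integrable_add integrable_diff)
      (auto intro: norm_triangle_sub order_trans[OF _ norm_triangle_ineq])
  also have "\<dots> = (\<integral>x. norm (\<phi> x - \<psi> x) \<partial>\<mu>) + (\<integral>x. norm (\<psi> x - \<theta> x) \<partial>\<mu>)"
    using assms by (intro Bochner_Integration.integral_add integrable_diff)
  finally show ?thesis .
qed

text \<open>Summable increments make the telescoping series of the \<open>\<phi> n\<close> converge
  absolutely almost everywhere; as all values lie in the bounded set \<open>Y\<close>, dominated
  convergence with bound \<open>diameter Y\<close> upgrades this to convergence in the mean.\<close>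

lemma L1_complete:
  fixes \<phi> :: "nat \<Rightarrow> 'a \<Rightarrow> 'a"
  assumes \<phi>: "\<And>n. \<phi> n \<in> \<mu> \<rightarrow>\<^sub>M borel_on Y"
    and summable: "summable (\<lambda>n. \<integral>x. norm (\<phi> (Suc n) x - \<phi> n x) \<partial>\<mu>)"
  obtains \<psi> where "\<psi> \<in> \<mu> \<rightarrow>\<^sub>M borel_on Y" "(\<lambda>n. \<integral>x. norm (\<phi> n x - \<psi> x) \<partial>\<mu>) \<longlonglongrightarrow> 0"
proof -
  obtain y0 where y0: "y0 \<in> Y"
    using Y_nonempty by auto
  have [measurable]: "\<phi> n \<in> borel_measurable \<mu>" for n
    using measurable_value(1)[OF \<phi>] .
  have "(\<integral>\<^sup>+x. (\<Sum>n. ennreal (norm (\<phi> (Suc n) x - \<phi> n x))) \<partial>\<mu>)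
      = (\<Sum>n. \<integral>\<^sup>+x. ennreal (norm (\<phi> (Suc n) x - \<phi> n x)) \<partial>\<mu>)"
    by (intro nn_integral_suminf) auto
  also have "\<dots> = (\<Sum>n. ennreal (\<integral>x. norm (\<phi> (Suc n) x - \<phi> n x) \<partial>\<mu>))"
    by (intro suminf_cong nn_integral_eq_integral integrable_diff \<phi>) auto
  also have "\<dots> = ennreal (\<Sum>n. \<integral>x. norm (\<phi> (Suc n) x - \<phi> n x) \<partial>\<mu>)"
    by (intro suminf_ennreal2 summable integral_nonneg) auto
  finally have "AE x in \<mu>. (\<Sum>n. ennreal (norm (\<phi> (Suc n) x - \<phi> n x))) \<noteq> \<infinity>"
    by (intro nn_integral_PInf_AE) auto
  then have lim: "AE x in \<mu>. (\<lambda>n. \<phi> n x) \<longlonglongrightarrow> lim (\<lambda>n. \<phi> n x)"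
  proof eventually_elim
    case (elim x)
    then have "summable (\<lambda>n. norm (\<phi> (Suc n) x - \<phi> n x))"
      by (intro summable_suminf_not_top) auto
    then have "summable (\<lambda>n. \<phi> (Suc n) x - \<phi> n x)"
      by (rule summable_norm_cancel)
    then have "(\<lambda>n. \<phi> 0 x + (\<Sum>i<n. \<phi> (Suc i) x - \<phi> i x)) \<longlonglongrightarrow> \<phi> 0 x + (\<Sum>i. \<phi> (Suc i) x - \<phi> i x)"
      by (intro tendsto_add tendsto_const summable_LIMSEQ)
    then have "(\<lambda>n. \<phi> n x) \<longlonglongrightarrow> \<phi> 0 x + (\<Sum>i. \<phi> (Suc i) x - \<phi> i x)"
      by (simp only: sum_lessThan_telescope[of "\<lambda>i. \<phi> i x"] add_diff_eq add_diff_cancel_left')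
    then have "convergent (\<lambda>n. \<phi> n x)"
      by (rule convergentI)
    then show ?case
      by (simp add: convergent_LIMSEQ_iff)
  qed
  have Y_sets [measurable]: "Y \<in> sets borel"
    using compact_imp_closed[OF compact_Y] by auto
  \<comment> \<open>Where the sequence diverges \<open>lim\<close> is arbitrary; the default
    \<open>y0\<close> keeps the values in \<open>Y\<close> everywhere, as measurability into
    \<open>borel_on Y\<close> requires.\<close>
  define \<psi> where "\<psi> x = (if lim (\<lambda>n. \<phi> n x) \<in> Y then lim (\<lambda>n. \<phi> n x) else y0)" for x
  have [measurable]: "\<psi> \<in> borel_measurable \<mu>"
    unfolding \<psi>_def by measurable
  have \<psi>: "\<psi> \<in> \<mu> \<rightarrow>\<^sub>M borel_on Y"
    using y0 by (auto simp: measurable_borel_on_iff) (auto simp: \<psi>_def)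
  have conv: "AE x in \<mu>. (\<lambda>n. norm (\<phi> n x - \<psi> x)) \<longlonglongrightarrow> 0"
    using lim AE_space
  proof eventually_elim
    case (elim x)
    have "lim (\<lambda>n. \<phi> n x) \<in> Y"
      by (rule closed_sequentially[OF compact_imp_closed[OF compact_Y] _ elim(1)])
        (rule measurable_value(2)[OF \<phi> elim(2)])
    then have "\<psi> x = lim (\<lambda>n. \<phi> n x)"
      by (simp add: \<psi>_def)
    then show ?case
      using elim(1) by (metis LIM_zero tendsto_norm_zero)
  qed
  have "(\<lambda>n. \<integral>x. norm (\<phi> n x - \<psi> x) \<partial>\<mu>) \<longlonglongrightarrow> (\<integral>x. 0 \<partial>\<mu>)"
    using conv
    by (rule integral_dominated_convergence[where w = "\<lambda>_. diameter Y", rotated 3])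
      (auto intro!: AE_I2 norm_diff_le_diameter measurable_value(2)[OF \<phi>] measurable_value(2)[OF \<psi>])
  then show ?thesis
    using that[OF \<psi>] by simp
qed

text \<open>The iteration is carried out on the maps \<open>R \<nu>\<close> in \<open>L\<^sup>1(\<mu>)\<close> rather than on their push-forwards: this
  needs neither the triangle inequality nor the completeness of \<open>wasserstein1\<close>.\<close>

lemma fixed_point_exists: "\<exists>\<nu>\<in>prob_measures Y. T \<nu> = \<nu>"
proof -
  obtain y0 where y0: "y0 \<in> Y"
    using Y_nonempty by auto
  \<comment> \<open>The iteration may start anywhere; the constant map makes \<open>\<nu>0\<close>
    the Dirac mass at \<open>y0\<close>.\<close>
  define \<nu>0 where "\<nu>0 = distr \<mu> (borel_on Y) (\<lambda>_. y0)"
  have \<nu>0: "\<nu>0 \<in> prob_measures Y"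
    unfolding \<nu>0_def using y0 by (intro distr_in_prob_measures prob_space_mu) auto
  define \<phi> where "\<phi> n = R ((T ^^ n) \<nu>0)" for n
  let ?N = "\<lambda>n. (T ^^ n) \<nu>0"
  let ?d = "\<lambda>f g. \<integral>x. norm (f x - g x) \<partial>\<mu>"
  have \<phi>: "\<phi> n \<in> \<mu> \<rightarrow>\<^sub>M borel_on Y" for n
    unfolding \<phi>_def by (intro R_mu T_funpow_in \<nu>0)
  \<comment> \<open>Index shift: \<open>\<phi> n\<close> is the reply to iterate \<open>n\<close>,
    so its law is iterate \<open>n + 1\<close>. The distance of two iterates is thereby bounded by
    that of the maps one index earlier.\<close>
  have N_Suc: "?N (Suc n) = distr \<mu> (borel_on Y) (\<phi> n)" for n
    by (simp add: T_def \<phi>_def)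
  have "?d (\<phi> (Suc (Suc n))) (\<phi> (Suc n)) \<le> k * ?d (\<phi> (Suc n)) (\<phi> n)" for n
  proof -
    have "?d (\<phi> (Suc (Suc n))) (\<phi> (Suc n)) \<le> k * wasserstein1 Y (?N (Suc (Suc n))) (?N (Suc n))"
      unfolding \<phi>_def by (intro R_lipschitz T_funpow_in \<nu>0)
    also have "\<dots> \<le> k * ?d (\<phi> (Suc n)) (\<phi> n)"
      unfolding N_Suc by (intro mult_left_mono wasserstein1_distr_le prob_space_mu \<phi> k)
    finally show ?thesis .
  qed
  then have geometric: "?d (\<phi> (Suc n)) (\<phi> n) \<le> k ^ n * ?d (\<phi> 1) (\<phi> 0)" for n
  proof (induction n)
    case (Suc n)
    have "?d (\<phi> (Suc (Suc n))) (\<phi> (Suc n)) \<le> k * (k ^ n * ?d (\<phi> 1) (\<phi> 0))"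
      using Suc mult_left_mono[OF Suc.IH[OF Suc.prems] k(1)] by (meson order_trans)
    then show ?case by (simp add: mult.assoc)
  qed simp
  have summable: "summable (\<lambda>n. ?d (\<phi> (Suc n)) (\<phi> n))"
  proof (rule summable_comparison_test')
    show "summable (\<lambda>n. k ^ n * ?d (\<phi> 1) (\<phi> 0))"
      using k by (intro summable_mult2 summable_geometric) simp
    show "norm (?d (\<phi> (Suc n)) (\<phi> n)) \<le> k ^ n * ?d (\<phi> 1) (\<phi> 0)" for n
      using geometric[of n] by (simp add: integral_nonneg)
  qed
  obtain \<psi> where \<psi>: "\<psi> \<in> \<mu> \<rightarrow>\<^sub>M borel_on Y" and lim: "(\<lambda>n. ?d (\<phi> n) \<psi>) \<longlonglongrightarrow> 0"
    by (rule L1_complete[OF \<phi> summable])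
  define \<nu> where "\<nu> = distr \<mu> (borel_on Y) \<psi>"
  have \<nu>: "\<nu> \<in> prob_measures Y"
    unfolding \<nu>_def by (intro distr_in_prob_measures prob_space_mu \<psi>)
  \<comment> \<open>\<open>\<phi> (Suc n)\<close> is the reply to the law of
    \<open>\<phi> n\<close>, and \<open>\<nu>\<close> is the law of \<open>\<psi>\<close>, so the
    replies to these two laws differ by at most \<open>k\<close> times the distance of
    \<open>\<psi>\<close> and \<open>\<phi> n\<close>. As \<open>n\<close> grows both terms vanish,
    which identifies the reply to \<open>\<nu>\<close> with \<open>\<psi>\<close> almost
    everywhere.\<close>
  have bound: "?d (R \<nu>) \<psi> \<le> k * ?d \<psi> (\<phi> n) + ?d (\<phi> (Suc n)) \<psi>" for n
  proof -
    have "?d (R \<nu>) \<psi> \<le> ?d (R \<nu>) (\<phi> (Suc n)) + ?d (\<phi> (Suc n)) \<psi>"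
      by (intro L1_triangle R_mu \<nu> \<phi> \<psi>)
    moreover have "?d (R \<nu>) (\<phi> (Suc n)) \<le> k * wasserstein1 Y \<nu> (?N (Suc n))"
      unfolding \<phi>_def by (intro R_lipschitz T_funpow_in \<nu>0 \<nu>)
    moreover have "k * wasserstein1 Y \<nu> (?N (Suc n)) \<le> k * ?d \<psi> (\<phi> n)"
      unfolding N_Suc \<nu>_def by (intro mult_left_mono wasserstein1_distr_le prob_space_mu \<phi> \<psi> k)
    ultimately show ?thesis by linarith
  qed
  have "?d \<psi> (\<phi> n) = ?d (\<phi> n) \<psi>" for n
    by (intro Bochner_Integration.integral_cong refl norm_minus_commute)
  then have "(\<lambda>n. k * ?d \<psi> (\<phi> n) + ?d (\<phi> (Suc n)) \<psi>) \<longlonglongrightarrow> k * 0 + 0"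
    using lim LIMSEQ_Suc[OF lim] by (simp only: tendsto_add tendsto_mult tendsto_const)
  then have "?d (R \<nu>) \<psi> \<le> k * 0 + 0"
    by (rule LIMSEQ_le_const) (intro exI allI impI bound)
  then have "?d (R \<nu>) \<psi> \<le> 0"
    by simp
  then have "distr \<mu> (borel_on Y) (R \<nu>) = distr \<mu> (borel_on Y) \<psi>"
    by (intro distr_eq_of_L1_zero R_mu \<nu> \<psi>)
  then have "T \<nu> = \<nu>"
    by (simp only: T_def \<nu>_def[symmetric])
  then show ?thesis
    using \<nu> by blast
qed

text \<open>The Wasserstein distance to the fixed point decays at least like \<open>k ^ n\<close>,
  and \<open>R_lipschitz\<close> transfers the decay to the replies. Both modes of convergence of
  the measures follow from this one.\<close>

lemma L1_iterates:
  assumes \<nu>: "\<nu> \<in> prob_measures Y" "T \<nu> = \<nu>" and \<nu>0: "\<nu>0 \<in> prob_measures Y"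
  shows "(\<lambda>n. \<integral>x. norm (R ((T ^^ n) \<nu>0) x - R \<nu> x) \<partial>\<mu>) \<longlonglongrightarrow> 0"
proof (rule tendsto_sandwich[OF _ _ tendsto_const])
  have W: "wasserstein1 Y ((T ^^ n) \<nu>0) \<nu> \<le> k ^ n * wasserstein1 Y \<nu>0 \<nu>" for n
  proof (induction n)
    case (Suc n)
    have "wasserstein1 Y ((T ^^ Suc n) \<nu>0) \<nu> = wasserstein1 Y (T ((T ^^ n) \<nu>0)) (T \<nu>)"
      using \<nu> by simp
    also have "\<dots> \<le> (\<integral>x. norm (R ((T ^^ n) \<nu>0) x - R \<nu> x) \<partial>\<mu>)"
      unfolding T_def[of "(T ^^ n) \<nu>0"] T_def[of \<nu>]
      by (intro wasserstein1_distr_le prob_space_mu R_mu \<nu> T_funpow_in \<nu>0)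
    also have "\<dots> \<le> k * wasserstein1 Y ((T ^^ n) \<nu>0) \<nu>"
      by (intro R_lipschitz T_funpow_in \<nu> \<nu>0)
    also have "\<dots> \<le> k * (k ^ n * wasserstein1 Y \<nu>0 \<nu>)"
      by (intro mult_left_mono Suc k)
    finally show ?case by (simp add: mult.assoc)
  qed simp
  have "(\<integral>x. norm (R ((T ^^ n) \<nu>0) x - R \<nu> x) \<partial>\<mu>) \<le> k * (k ^ n * wasserstein1 Y \<nu>0 \<nu>)" for n
    using R_lipschitz[OF T_funpow_in[OF \<nu>0, of n] \<nu>(1)] mult_left_mono[OF W[of n] k(1)] by simp
  then show "\<forall>\<^sub>F n in sequentially. (\<integral>x. norm (R ((T ^^ n) \<nu>0) x - R \<nu> x) \<partial>\<mu>) \<le> k * (k ^ n * wasserstein1 Y \<nu>0 \<nu>)"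
    by (intro always_eventually allI)
  have "(\<lambda>n. k * (k ^ n * wasserstein1 Y \<nu>0 \<nu>)) \<longlonglongrightarrow> k * (0 * wasserstein1 Y \<nu>0 \<nu>)"
    using k by (intro tendsto_mult tendsto_const LIMSEQ_power_zero) simp
  then show "(\<lambda>n. k * (k ^ n * wasserstein1 Y \<nu>0 \<nu>)) \<longlonglongrightarrow> 0"
    by simp
  show "\<forall>\<^sub>F n in sequentially. 0 \<le> (\<integral>x. norm (R ((T ^^ n) \<nu>0) x - R \<nu> x) \<partial>\<mu>)"
    by (intro always_eventually allI integral_nonneg) simp
qed

text \<open>From the first step on every iterate is a push-forward of \<open>\<mu>\<close>, and so
  is \<open>\<nu>\<close>; the shift by one index makes the coupling bounds available although
  \<open>\<nu>0\<close> is arbitrary.\<close>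

lemma iterates_wasserstein1:
  assumes \<nu>: "\<nu> \<in> prob_measures Y" "T \<nu> = \<nu>" and \<nu>0: "\<nu>0 \<in> prob_measures Y"
  shows "(\<lambda>n. wasserstein1 Y ((T ^^ n) \<nu>0) \<nu>) \<longlonglongrightarrow> 0"
proof (rule LIMSEQ_imp_Suc, rule tendsto_sandwich[OF _ _ tendsto_const L1_iterates[OF assms]])
  have in_P: "(T ^^ n) \<nu>0 \<in> prob_measures Y" for n
    by (intro T_funpow_in \<nu>0)
  have eq: "wasserstein1 Y ((T ^^ Suc n) \<nu>0) \<nu>
      = wasserstein1 Y (distr \<mu> (borel_on Y) (R ((T ^^ n) \<nu>0))) (distr \<mu> (borel_on Y) (R \<nu>))" for n
    using \<nu> by (simp add: T_def)
  show "\<forall>\<^sub>F n in sequentially. 0 \<le> wasserstein1 Y ((T ^^ Suc n) \<nu>0) \<nu>"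
    unfolding eq by (intro always_eventually allI wasserstein1_distr_nonneg prob_space_mu R_mu in_P \<nu>)
  show "\<forall>\<^sub>F n in sequentially. wasserstein1 Y ((T ^^ Suc n) \<nu>0) \<nu> \<le> (\<integral>x. norm (R ((T ^^ n) \<nu>0) x - R \<nu> x) \<partial>\<mu>)"
    unfolding eq by (intro always_eventually allI wasserstein1_distr_le prob_space_mu R_mu in_P \<nu>)
qed

text \<open>After a shift by one index, integrals against the iterates become integrals of
  \<open>f (\<phi> n x)\<close> against \<open>\<mu>\<close>. The affine modulus of continuity
  bounds the error by \<open>e / 2\<close> plus a multiple of an \<open>L1\<close> distance that
  tends to \<open>0\<close>.\<close>

lemma iterates_weak_star:
  assumes \<nu>: "\<nu> \<in> prob_measures Y" "T \<nu> = \<nu>" and \<nu>0: "\<nu>0 \<in> prob_measures Y"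
  shows "weak_star_conv Y (\<lambda>n. (T ^^ n) \<nu>0) \<nu>"
  unfolding weak_star_conv_def
proof (intro allI impI)
  fix f :: "'a \<Rightarrow> real" assume f: "continuous_on Y f"
  define \<phi> where "\<phi> n = R ((T ^^ n) \<nu>0)" for n
  have \<phi>: "\<phi> n \<in> \<mu> \<rightarrow>\<^sub>M borel_on Y" for n
    unfolding \<phi>_def by (intro R_mu T_funpow_in \<nu>0)
  have R: "R \<nu> \<in> \<mu> \<rightarrow>\<^sub>M borel_on Y"
    by (intro R_mu \<nu>)
  obtain B where B: "\<And>a. a \<in> Y \<Longrightarrow> \<bar>f a\<bar> \<le> B"
    using compact_imp_bounded[OF compact_continuous_image[OF f compact_Y]]
    unfolding bounded_iff by auto
  have int: "integrable \<mu> (\<lambda>x. f (\<theta> x))" if "\<theta> \<in> \<mu> \<rightarrow>\<^sub>M borel_on Y" for \<theta>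
    using B measurable_value(2)[OF that] measurable_compose[OF that borel_measurable_borel_on[OF f]]
    by (intro mu.integrable_const_bound[where B = B]) (auto intro!: AE_I2)
  have "(\<lambda>n. \<integral>x. f (\<phi> n x) \<partial>\<mu>) \<longlonglongrightarrow> (\<integral>x. f (R \<nu> x) \<partial>\<mu>)"
  proof (rule LIMSEQ_I)
    fix e :: real assume "0 < e"
    then obtain K where K: "0 \<le> K" "\<And>a b. a \<in> Y \<Longrightarrow> b \<in> Y \<Longrightarrow> \<bar>f a - f b\<bar> \<le> e / 2 + K * dist a b"
      using continuous_on_compact_affine_modulus[OF compact_Y f, of "e / 2"] by auto
    let ?I = "\<lambda>n. \<integral>x. norm (\<phi> n x - R \<nu> x) \<partial>\<mu>"
    have le: "\<bar>(\<integral>x. f (\<phi> n x) \<partial>\<mu>) - (\<integral>x. f (R \<nu> x) \<partial>\<mu>)\<bar> \<le> e / 2 + K * ?I n" for n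
    proof -
      have "\<bar>(\<integral>x. f (\<phi> n x) \<partial>\<mu>) - (\<integral>x. f (R \<nu> x) \<partial>\<mu>)\<bar> = \<bar>\<integral>x. f (\<phi> n x) - f (R \<nu> x) \<partial>\<mu>\<bar>"
        using int[OF \<phi>] int[OF R] by simp
      also have "\<dots> \<le> (\<integral>x. \<bar>f (\<phi> n x) - f (R \<nu> x)\<bar> \<partial>\<mu>)"
        by (rule integral_abs_bound)
      also have "\<dots> \<le> (\<integral>x. e / 2 + K * norm (\<phi> n x - R \<nu> x) \<partial>\<mu>)"
        using int[OF \<phi>] int[OF R] integrable_diff[OF \<phi> R] K(2) measurable_value(2)[OF \<phi>] measurable_value(2)[OF R]
        by (intro integral_mono) (auto simp: dist_norm)
      also have "\<dots> = e / 2 + K * ?I n"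
        using integrable_diff[OF \<phi> R] by (simp add: mu.prob_space)
      finally show ?thesis .
    qed
    have "(\<lambda>n. K * ?I n) \<longlonglongrightarrow> K * 0"
      unfolding \<phi>_def by (intro tendsto_mult tendsto_const L1_iterates assms)
    then obtain N where "\<And>n. n \<ge> N \<Longrightarrow> \<bar>K * ?I n\<bar> < e / 2"
      using \<open>0 < e\<close> LIMSEQ_D[of "\<lambda>n. K * ?I n" 0 "e / 2"] by auto
    then show "\<exists>N. \<forall>n\<ge>N. norm ((\<integral>x. f (\<phi> n x) \<partial>\<mu>) - (\<integral>x. f (R \<nu> x) \<partial>\<mu>)) < e"
      using le by (intro exI[of _ N]) (smt (verit) real_norm_def field_sum_of_halves)
  qed
  moreover have "(\<integral>y. f y \<partial>(T ^^ Suc n) \<nu>0) = (\<integral>x. f (\<phi> n x) \<partial>\<mu>)" for n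
    using integral_distr[OF \<phi> borel_measurable_borel_on[OF f], of n] by (simp add: T_def \<phi>_def)
  moreover have "(\<integral>y. f y \<partial>\<nu>) = (\<integral>x. f (R \<nu> x) \<partial>\<mu>)"
    using integral_distr[OF R borel_measurable_borel_on[OF f]]
    unfolding T_def[symmetric] \<nu>(2) .
  ultimately have "(\<lambda>n. \<integral>y. f y \<partial>(T ^^ Suc n) \<nu>0) \<longlonglongrightarrow> (\<integral>y. f y \<partial>\<nu>)"
    by (simp only:)
  then show "(\<lambda>n. \<integral>y. f y \<partial>(T ^^ n) \<nu>0) \<longlonglongrightarrow> (\<integral>y. f y \<partial>\<nu>)"
    by (rule LIMSEQ_imp_Suc)
qed

text \<open>The optimality set in the definition of equilibrium is the graph of the reply to the
  second marginal. A measure with first marginal \<open>\<mu>\<close> carried by that graph is the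
  image of \<open>\<mu>\<close> under the graph map, and its second marginal is then
  \<open>T \<nu>\<close>.\<close>

lemma cournot_nash_iff:
  assumes optimal: "\<And>\<nu> x y. \<nu> \<in> prob_measures Y \<Longrightarrow> x \<in> X \<Longrightarrow> y \<in> Y \<Longrightarrow>
      c x y + V \<nu> y = (INF z\<in>Y. c x z + V \<nu> z) \<longleftrightarrow> y = R \<nu> x"
  shows "cournot_nash X Y c V \<mu> \<gamma> \<longleftrightarrow>
    (\<exists>\<nu>\<in>prob_measures Y. T \<nu> = \<nu> \<and> \<gamma> = distr \<mu> (borel_on (X \<times> Y)) (\<lambda>x. (x, R \<nu> x)))"
proof -
  have proj: "fst \<in> borel_on (X \<times> Y) \<rightarrow>\<^sub>M borel_on X" "snd \<in> borel_on (X \<times> Y) \<rightarrow>\<^sub>M borel_on Y"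
    unfolding measurable_borel_on_iff
    by (auto intro!: borel_measurable_borel_on continuous_intros)
  have id_mu: "(\<lambda>x. x) \<in> \<mu> \<rightarrow>\<^sub>M borel_on X"
    by (simp add: measurable_cong_sets[OF sets_mu refl])
  have graph: "(\<lambda>x. (x, R \<nu> x)) \<in> borel_on X \<rightarrow>\<^sub>M borel_on (X \<times> Y)" if "\<nu> \<in> prob_measures Y" for \<nu>
  proof -
    have "(\<lambda>x. x) \<in> borel_measurable (borel_on X)"
      by (intro borel_measurable_borel_on continuous_intros)
    then show ?thesis
      using R_measurable[OF that] by (auto simp: measurable_borel_on_iff)
  qed
  note graph_mu = graph[unfolded measurable_cong_sets[OF sets_mu[symmetric] refl]]
  define G where "G \<nu> = {p \<in> X \<times> Y. snd p = R \<nu> (fst p)}" for \<nu>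
  have G: "{(x, y). x \<in> X \<and> y \<in> Y \<and> c x y + V \<nu> y = (INF z\<in>Y. c x z + V \<nu> z)} = G \<nu>"
    if "\<nu> \<in> prob_measures Y" for \<nu>
    using optimal[OF that] by (auto simp: G_def)
  show ?thesis
  proof
    assume CN: "cournot_nash X Y c V \<mu> \<gamma>"
    define \<nu> where "\<nu> = distr \<gamma> (borel_on Y) snd"
    have \<gamma>: "prob_space \<gamma>" "sets \<gamma> = sets (borel_on (X \<times> Y))" and fst: "distr \<gamma> (borel_on X) fst = \<mu>"
      using CN by (auto simp: cournot_nash_def prob_measures_iff)
    have space: "space \<gamma> = X \<times> Y"
      using sets_eq_imp_space_eq[OF \<gamma>(2)] by simp
    note proj' = proj[unfolded measurable_cong_sets[OF \<gamma>(2)[symmetric] refl]]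
    interpret \<gamma>: prob_space \<gamma> by fact
    have \<nu>: "\<nu> \<in> prob_measures Y"
      unfolding \<nu>_def using \<gamma>(1) proj'(2) by (rule distr_in_prob_measures)
    have "measure \<gamma> (G \<nu>) = 1"
      using CN by (simp add: cournot_nash_def Let_def \<nu>_def[symmetric] G[OF \<nu>])
    then have "AE p in \<gamma>. p \<in> G \<nu>"
      by (rule \<gamma>.AE_prob_1)
    then have AE: "AE p in \<gamma>. p = (fst p, R \<nu> (fst p))"
      by eventually_elim (auto simp: G_def prod_eq_iff)
    have "\<gamma> = distr \<gamma> (borel_on (X \<times> Y)) (\<lambda>p. p)"
      using \<gamma>(2) by (intro distr_id2[symmetric]) simp
    \<comment> \<open>The identity is replaced by an almost everywhere equal map that factors
      through the first coordinate, so that \<open>\<gamma>\<close> enters only through its first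
      marginal.\<close>
    also have "\<dots> = distr \<gamma> (borel_on (X \<times> Y)) (\<lambda>p. (fst p, R \<nu> (fst p)))"
      using AE measurable_compose[OF proj'(1) graph[OF \<nu>]]
      by (intro distr_cong_AE) (auto simp: measurable_cong_sets[OF \<gamma>(2) refl])
    also have "\<dots> = distr \<mu> (borel_on (X \<times> Y)) (\<lambda>x. (x, R \<nu> x))"
      unfolding fst[symmetric] using distr_distr[OF graph[OF \<nu>] proj'(1)] by (simp add: o_def)
    finally have eq: "\<gamma> = distr \<mu> (borel_on (X \<times> Y)) (\<lambda>x. (x, R \<nu> x))" .
    have "distr (distr \<mu> (borel_on (X \<times> Y)) (\<lambda>x. (x, R \<nu> x))) (borel_on Y) snd = T \<nu>"
      by (simp add: distr_distr[OF proj(2) graph_mu[OF \<nu>]] o_def T_def)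
    then have "T \<nu> = \<nu>"
      unfolding eq[symmetric] \<nu>_def[symmetric] by (rule sym)
    then show "\<exists>\<nu>\<in>prob_measures Y. T \<nu> = \<nu> \<and> \<gamma> = distr \<mu> (borel_on (X \<times> Y)) (\<lambda>x. (x, R \<nu> x))"
      using \<nu> eq by (intro bexI[of _ \<nu>] conjI)
  next
    assume "\<exists>\<nu>\<in>prob_measures Y. T \<nu> = \<nu> \<and> \<gamma> = distr \<mu> (borel_on (X \<times> Y)) (\<lambda>x. (x, R \<nu> x))"
    then obtain \<nu> where \<nu>: "\<nu> \<in> prob_measures Y" "T \<nu> = \<nu>"
      and \<gamma>: "\<gamma> = distr \<mu> (borel_on (X \<times> Y)) (\<lambda>x. (x, R \<nu> x))"
      by blast
    have fst: "distr \<gamma> (borel_on X) fst = \<mu>"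
      unfolding \<gamma> distr_distr[OF proj(1) graph_mu[OF \<nu>(1)]] using distr_id2[OF sets_mu[symmetric]] by (simp add: o_def)
    have snd: "distr \<gamma> (borel_on Y) snd = \<nu>"
      unfolding \<gamma> distr_distr[OF proj(2) graph_mu[OF \<nu>(1)]] using \<nu>(2) by (simp add: o_def T_def)
    \<comment> \<open>The formula for the measure of a set under a push-forward requires a
      measurable set; the graph is the set where two measurable maps agree.\<close>
    have "G \<nu> \<in> sets (borel_on (X \<times> Y))"
    proof -
      have [measurable]: "snd \<in> borel_measurable (borel_on (X \<times> Y))"
        "(\<lambda>p. R \<nu> (fst p)) \<in> borel_measurable (borel_on (X \<times> Y))"
        using proj(2) measurable_compose[OF proj(1) R_measurable[OF \<nu>(1)]]
        by (auto simp: measurable_borel_on_iff)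
      have "{p \<in> space (borel_on (X \<times> Y)). snd p = R \<nu> (fst p)} \<in> sets (borel_on (X \<times> Y))"
        by measurable
      then show ?thesis
        by (simp add: G_def)
    qed
    then have "measure \<gamma> (G \<nu>) = measure \<mu> ((\<lambda>x. (x, R \<nu> x)) -` G \<nu> \<inter> space \<mu>)"
      unfolding \<gamma> by (intro measure_distr graph_mu \<nu>)
    also have "(\<lambda>x. (x, R \<nu> x)) -` G \<nu> \<inter> space \<mu> = space \<mu>"
      using measurable_value(2)[OF R_mu[OF \<nu>(1)]] by (auto simp: G_def space_mu)
    finally have "measure \<gamma> (G \<nu>) = 1"
      by (simp add: mu.prob_space)
    moreover have "\<gamma> \<in> prob_measures (X \<times> Y)"
      unfolding \<gamma> by (intro distr_in_prob_measures prob_space_mu graph_mu \<nu>)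
    ultimately show "cournot_nash X Y c V \<mu> \<gamma>"
      unfolding cournot_nash_def using fst by (simp add: snd G[OF \<nu>(1)])
  qed
qed

end

section \<open>The contraction estimate\<close>

text \<open>The Radon-Nikodym density stays below its essential supremum almost everywhere, so it
  can be pulled out of the integral as a constant.\<close>

lemma nn_integral_le_density_Linf_norm:
  fixes X :: "'a::euclidean_space set"
  assumes X: "X \<in> sets borel" and mu: "\<mu> \<in> prob_measures X"
    and ac: "absolutely_continuous (lebesgue_on_borel X) \<mu>"
    and f: "f \<in> borel_measurable (borel_on X)"
  shows "(\<integral>\<^sup>+x. f x \<partial>\<mu>) \<le> density_Linf_norm X \<mu> * (\<integral>\<^sup>+x\<in>X. f x \<partial>lborel)"
proof -
  let ?L = "lebesgue_on_borel X"
  have sets_L: "sets ?L = sets (borel_on X)"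
    unfolding lebesgue_on_borel_def borel_on_def by (rule sets_restrict_space_cong) simp
  interpret L: sigma_finite_measure ?L
    unfolding lebesgue_on_borel_def using X
    by (intro sigma_finite_measure_restrict_space sigma_finite_lborel) simp
  have sets_mu: "sets \<mu> = sets ?L"
    using mu by (simp add: prob_measures_iff sets_L)
  have f_L [measurable]: "f \<in> borel_measurable ?L"
    using f by (simp add: measurable_cong_sets[OF sets_L refl])
  have "(\<integral>\<^sup>+x. f x \<partial>\<mu>) = (\<integral>\<^sup>+x. RN_deriv ?L \<mu> x * f x \<partial>?L)"
    by (rule L.RN_deriv_nn_integral[OF ac sets_mu f_L])
  also have "\<dots> \<le> (\<integral>\<^sup>+x. density_Linf_norm X \<mu> * f x \<partial>?L)"
  proof (rule nn_integral_mono_AE)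
    show "AE x in ?L. RN_deriv ?L \<mu> x * f x \<le> density_Linf_norm X \<mu> * f x"
      using esssup_AE[of "RN_deriv ?L \<mu>" ?L]
      by eventually_elim (simp add: density_Linf_norm_def mult_right_mono)
  qed
  also have "\<dots> = density_Linf_norm X \<mu> * (\<integral>\<^sup>+x. f x \<partial>?L)"
    by (rule nn_integral_cmult) measurable
  also have "(\<integral>\<^sup>+x. f x \<partial>?L) = (\<integral>\<^sup>+x\<in>X. f x \<partial>lborel)"
    unfolding lebesgue_on_borel_def using X by (intro nn_integral_restrict_space) simp
  finally show ?thesis .
qed

text \<open>The critical equations read \<open>?y + grad v ?y = x = ?z + grad w ?z\<close>, so the
  increment of \<open>id + grad v\<close> between \<open>?y\<close> and \<open>?z\<close> reduces to
  the difference of the two gradients at the single point \<open>?z\<close>.\<close>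

lemma norm_resolvent_diff_le:
  assumes v: "admissible_potential X U v lam" and w: "admissible_potential X U w lam" and x: "x \<in> X"
  shows "(1 + lam) * norm (resolvent (closure U) v x - resolvent (closure U) w x)
    \<le> norm (grad v (resolvent (closure U) w x) - grad w (resolvent (closure U) w x))"
proof -
  let ?y = "resolvent (closure U) v x" and ?z = "resolvent (closure U) w x"
  have "(1 + lam) * norm (?y - ?z) \<le> norm ((?y + grad v ?y) - (?z + grad v ?z))"
    by (intro admissible_potential.id_plus_grad_expansive[OF v] admissible_potential.resolvent_in_closure[OF v]
        admissible_potential.resolvent_in_closure[OF w])
  also have "(?y + grad v ?y) - (?z + grad v ?z) = (?z + grad w ?z) - (?z + grad v ?z)"
    by (simp only: admissible_potential.resolvent_critical[OF v x]
        admissible_potential.resolvent_critical[OF w x])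
  also have "norm \<dots> = norm (grad v ?z - grad w ?z)"
    by (simp add: norm_minus_commute)
  finally show ?thesis .
qed

text \<open>The pointwise bound depends on \<open>x\<close> only through the resolvent of
  \<open>w\<close>, so a single substitution is made and the Jacobian bound is asked of
  \<open>w\<close> alone.\<close>

lemma integral_resolvent_diff_le:
  assumes v: "admissible_potential X U v lam" and w: "admissible_potential X U w lam"
    and mu: "\<mu> \<in> prob_measures X" and ac: "absolutely_continuous (lebesgue_on_borel X) \<mu>"
    and bounded: "density_Linf_norm X \<mu> < \<infinity>"
    and det: "\<And>y. y \<in> closure U \<Longrightarrow> det (mat 1 + hessian w y) \<le> M" and M: "0 \<le> M"
  shows "(1 + lam) * (\<integral>x. norm (resolvent (closure U) v x - resolvent (closure U) w x) \<partial>\<mu>)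
    \<le> M * enn2real (density_Linf_norm X \<mu>) * (LINT y:closure U|lborel. norm (grad v y - grad w y))"
proof -
  interpret v: admissible_potential X U v lam by fact
  interpret w: admissible_potential X U w lam by fact
  let ?Y = "closure U" and ?D = "density_Linf_norm X \<mu>"
  define f where "f y = norm (grad v y - grad w y)" for y
  define J where "J = (LINT y:?Y|lborel. f y)"
  have sets_mu: "sets \<mu> = sets (borel_on X)" and prob: "prob_space \<mu>"
    using mu by (auto simp: prob_measures_iff)
  have space_mu: "space \<mu> = X"
    using sets_eq_imp_space_eq[OF sets_mu] by simp
  interpret mu: prob_space \<mu> by (rule prob)
  have f: "continuous_on ?Y f"
    unfolding f_def by (intro continuous_intros v.grad_continuous w.grad_continuous)
  have fR: "continuous_on X (\<lambda>x. f (w.R x))"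
    using w.resolvent_in_closure by (intro continuous_on_compose2[OF f w.resolvent_continuous]) auto
  have J: "(\<integral>\<^sup>+y\<in>?Y. ennreal (f y) \<partial>lborel) = ennreal J"
    unfolding J_def by (intro nn_integral_continuous_on_compact v.compact_closure_U f) (simp add: f_def)
  have J_nonneg: "0 \<le> J"
    unfolding J_def set_lebesgue_integral_def by (intro Bochner_Integration.integral_nonneg) (simp add: f_def)
  have integrable: "integrable \<mu> g" if g: "continuous_on X g" for g :: "_ \<Rightarrow> real"
  proof -
    obtain B where "\<And>x. x \<in> X \<Longrightarrow> norm (g x) \<le> B"
      using compact_imp_bounded[OF compact_continuous_image[OF g v.compact_X]]
      unfolding bounded_iff by auto
    moreover have "g \<in> borel_measurable \<mu>"
      using borel_measurable_borel_on[OF g] by (simp add: measurable_cong_sets[OF sets_mu refl])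
    ultimately show ?thesis
      by (intro mu.integrable_const_bound[where B = B] AE_I2) (auto simp: space_mu)
  qed
  \<comment> \<open>The chain of estimates runs in \<open>ennreal\<close>; finiteness of the density
    bound and of \<open>J\<close> allows the return to real numbers at its end.\<close>
  have "ennreal (\<integral>x. f (w.R x) \<partial>\<mu>) = (\<integral>\<^sup>+x. ennreal (f (w.R x)) \<partial>\<mu>)"
    by (intro nn_integral_eq_integral[symmetric] integrable fR) (simp add: f_def)
  also have "\<dots> \<le> ?D * (\<integral>\<^sup>+x\<in>X. ennreal (f (w.R x)) \<partial>lborel)"
    using borel_measurable_borel_on[OF fR] compact_imp_closed[OF v.compact_X]
    by (intro nn_integral_le_density_Linf_norm mu ac) auto
  also have "\<dots> \<le> ?D * (ennreal M * ennreal J)"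
    unfolding J[symmetric]
    by (intro mult_left_mono w.nn_integral_resolvent_le det M f) (auto simp: f_def)
  also have "?D = ennreal (enn2real ?D)"
    using bounded by simp
  finally have le: "(\<integral>x. f (w.R x) \<partial>\<mu>) \<le> enn2real ?D * (M * J)"
    using M J_nonneg by (simp add: ennreal_mult'[symmetric])
  have "(1 + lam) * (\<integral>x. norm (v.R x - w.R x) \<partial>\<mu>) = (\<integral>x. (1 + lam) * norm (v.R x - w.R x) \<partial>\<mu>)"
    by simp
  also have "\<dots> \<le> (\<integral>x. f (w.R x) \<partial>\<mu>)"
  proof (intro integral_mono integrable fR)
    show "continuous_on X (\<lambda>x. (1 + lam) * norm (v.R x - w.R x))"
      by (intro continuous_intros v.resolvent_continuous w.resolvent_continuous)
    show "(1 + lam) * norm (v.R x - w.R x) \<le> f (w.R x)" if "x \<in> space \<mu>" for x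
      unfolding f_def using that by (intro norm_resolvent_diff_le[OF v w]) (simp add: space_mu)
  qed
  also note le
  finally show ?thesis
    by (simp add: J_def f_def mult_ac)
qed

theorem theorem5p1:
  fixes \<Omega> U X Y :: "(real^'n) set"
    and \<mu> :: "(real^'n) measure"
    and V :: "(real^'n) measure \<Rightarrow> real^'n \<Rightarrow> real"
    and lam C M :: real
    and T :: "(real^'n) measure \<Rightarrow> (real^'n) measure"
  assumes Omega: "open \<Omega>" "bounded \<Omega>" "convex \<Omega>"
    and U: "open U" "bounded U" "convex U" "U \<noteq> {}"
    and X: "X = closure \<Omega>" and Y: "Y = closure U"
    and mu: "\<mu> \<in> prob_measures X"
    and mu_ac: "absolutely_continuous (lebesgue_on_borel X) \<mu>"
    and mu_bounded: "density_Linf_norm X \<mu> < \<infinity>"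
    and V_convex: "\<And>\<nu>. \<nu> \<in> prob_measures Y \<Longrightarrow> convex_on Y (V \<nu>)"
    and V_C2: "\<And>\<nu>. \<nu> \<in> prob_measures Y \<Longrightarrow> C2_on Y (V \<nu>)"
    and interior_min: "\<And>\<nu> x y. \<nu> \<in> prob_measures Y \<Longrightarrow> x \<in> X \<Longrightarrow>
          is_arg_min (\<lambda>y. quad_cost x y + V \<nu> y) (\<lambda>y. y \<in> Y) y \<Longrightarrow> y \<in> U"
    and constants: "lam > 0" "C \<ge> 0" "M > 0"
    and hess_lower: "\<And>\<nu> y. \<nu> \<in> prob_measures Y \<Longrightarrow> y \<in> Y \<Longrightarrow>
          loewner_le (mat lam) (hessian (V \<nu>) y)"
    and det_upper: "\<And>\<nu> y. \<nu> \<in> prob_measures Y \<Longrightarrow> y \<in> Y \<Longrightarrow>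
          det (mat 1 + hessian (V \<nu>) y) \<le> M"
    and grad_lipschitz: "\<And>\<nu>1 \<nu>2. \<nu>1 \<in> prob_measures Y \<Longrightarrow> \<nu>2 \<in> prob_measures Y \<Longrightarrow>
          (LINT y:Y|lborel. norm (grad (V \<nu>1) y - grad (V \<nu>2) y)) \<le> C * wasserstein1 Y \<nu>1 \<nu>2"
    and small: "M * C * enn2real (density_Linf_norm X \<mu>) < 1 + lam"
    and T: "T = best_reply_map Y V \<mu>"
  shows "contraction_on (prob_measures Y) (wasserstein1 Y) T \<and>
    (\<exists>\<nu>\<in>prob_measures Y. T \<nu> = \<nu> \<and> (\<forall>\<nu>'\<in>prob_measures Y. T \<nu>' = \<nu>' \<longrightarrow> \<nu>' = \<nu>) \<and>
      (\<forall>\<nu>0\<in>prob_measures Y.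
        (\<lambda>n. wasserstein1 Y ((T ^^ n) \<nu>0) \<nu>) \<longlonglongrightarrow> 0 \<and>
        weak_star_conv Y (\<lambda>n. (T ^^ n) \<nu>0) \<nu>)) \<and>
    (\<exists>!\<gamma>. cournot_nash X Y quad_cost V \<mu> \<gamma>)"
proof -
  let ?D = "enn2real (density_Linf_norm X \<mu>)"
  \<comment> \<open>The factors come from the Jacobian, the dependence of the gradients on the
    measure, the density, and the expansion of \<open>id + grad\<close>; the assumption
    \<open>small\<close> says \<open>k < 1\<close>.\<close>
  define k where "k = M * C * ?D / (1 + lam)"
  have compact_X: "compact X" and compact_Y: "compact Y" and Y_nonempty: "Y \<noteq> {}"
    using Omega U by (auto simp: X Y)
  have potential: "admissible_potential X U (V \<nu>) lam" if "\<nu> \<in> prob_measures Y" for \<nu>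
    using compact_X U constants(1) V_C2[OF that] interior_min[OF that] hess_lower[OF that]
    unfolding Y by unfold_locales
  have continuous: "continuous_on X (resolvent Y (V \<nu>))" if "\<nu> \<in> prob_measures Y" for \<nu>
    unfolding Y by (rule admissible_potential.resolvent_continuous[OF potential[OF that]])
  have in_Y: "resolvent Y (V \<nu>) x \<in> Y" if "\<nu> \<in> prob_measures Y" for \<nu> x
    unfolding Y by (rule admissible_potential.resolvent_in_closure[OF potential[OF that]])
  interpret contractive_reply X Y \<mu> "\<lambda>\<nu>. resolvent Y (V \<nu>)" k
  proof
    show "\<mu> \<in> prob_measures X" "compact Y" "Y \<noteq> {}"
      by fact+
    show "0 \<le> k" "k < 1"
      using constants small by (auto simp: k_def)
    show "resolvent Y (V \<nu>) \<in> borel_on X \<rightarrow>\<^sub>M borel_on Y" if "\<nu> \<in> prob_measures Y" for \<nu>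
      using borel_measurable_borel_on[OF continuous[OF that]] in_Y[OF that]
      by (auto simp: measurable_borel_on_iff)
    show "(\<integral>x. norm (resolvent Y (V \<nu>1) x - resolvent Y (V \<nu>2) x) \<partial>\<mu>) \<le> k * wasserstein1 Y \<nu>1 \<nu>2"
      if \<nu>: "\<nu>1 \<in> prob_measures Y" "\<nu>2 \<in> prob_measures Y" for \<nu>1 \<nu>2
    proof -
      let ?I = "\<integral>x. norm (resolvent Y (V \<nu>1) x - resolvent Y (V \<nu>2) x) \<partial>\<mu>"
      have "(1 + lam) * ?I \<le> M * ?D * (LINT y:Y|lborel. norm (grad (V \<nu>1) y - grad (V \<nu>2) y))"
        using integral_resolvent_diff_le[OF potential[OF \<nu>(1)] potential[OF \<nu>(2)] mu mu_ac mu_bounded]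
          det_upper[OF \<nu>(2)] constants(3)
        unfolding Y by simp
      also have "\<dots> \<le> M * ?D * (C * wasserstein1 Y \<nu>1 \<nu>2)"
        using constants by (intro mult_left_mono grad_lipschitz \<nu>) auto
      finally show ?thesis
        using constants(1) by (simp add: k_def field_simps)
    qed
  qed
  have T_eq: "T = local.T"
    by (simp add: fun_eq_iff T best_reply_map_def T_def)
  obtain \<nu> where \<nu>: "\<nu> \<in> prob_measures Y" "local.T \<nu> = \<nu>"
    using fixed_point_exists by blast
  have optimal: "quad_cost x y + V \<nu> y = (INF z\<in>Y. quad_cost x z + V \<nu> z) \<longleftrightarrow> y = resolvent Y (V \<nu>) x"
    if "\<nu> \<in> prob_measures Y" "x \<in> X" "y \<in> Y" for \<nu> x y
    using admissible_potential.resolvent_eq_iff[OF potential[OF that(1)] that(2)] that(3)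
    unfolding Y by blast
  have equilibrium_iff: "cournot_nash X Y quad_cost V \<mu> \<gamma> \<longleftrightarrow> (\<exists>\<nu>\<in>prob_measures Y. local.T \<nu> = \<nu> \<and>
      \<gamma> = distr \<mu> (borel_on (X \<times> Y)) (\<lambda>x. (x, resolvent Y (V \<nu>) x)))" for \<gamma>
    by (rule cournot_nash_iff) (rule optimal)
  show ?thesis
    unfolding T_eq
  proof (intro conjI bexI[OF _ \<nu>(1)] ballI impI)
    show "contraction_on (prob_measures Y) (wasserstein1 Y) (local.T)"
      by (rule contraction)
    show "local.T \<nu> = \<nu>"
      by (rule \<nu>(2))
    show "\<nu>' = \<nu>" if "\<nu>' \<in> prob_measures Y" "local.T \<nu>' = \<nu>'" for \<nu>'
      by (rule fixed_point_unique[OF that(1) \<nu>(1) that(2) \<nu>(2)])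
    show "(\<lambda>n. wasserstein1 Y ((local.T ^^ n) \<nu>0) \<nu>) \<longlonglongrightarrow> 0"
      "weak_star_conv Y (\<lambda>n. (local.T ^^ n) \<nu>0) \<nu>"
      if "\<nu>0 \<in> prob_measures Y" for \<nu>0
      by (rule iterates_wasserstein1[OF \<nu> that] iterates_weak_star[OF \<nu> that])+
    show "\<exists>!\<gamma>. cournot_nash X Y quad_cost V \<mu> \<gamma>"
    proof (rule ex1I)
      show "cournot_nash X Y quad_cost V \<mu> (distr \<mu> (borel_on (X \<times> Y)) (\<lambda>x. (x, resolvent Y (V \<nu>) x)))"
        unfolding equilibrium_iff by (intro bexI[OF _ \<nu>(1)] conjI \<nu>(2) refl)
      \<comment> \<open>Every equilibrium arises from some fixed point of the reply map, and there
        is only one.\<close>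
      show "\<gamma> = distr \<mu> (borel_on (X \<times> Y)) (\<lambda>x. (x, resolvent Y (V \<nu>) x))"
        if "cournot_nash X Y quad_cost V \<mu> \<gamma>" for \<gamma>
        using that fixed_point_unique[OF _ \<nu>(1) _ \<nu>(2)] unfolding equilibrium_iff by blast
    qed
  qed
qed

end
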